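(* Let $p$ be an odd prime. If $G$ is a finite group of minimal order in which all groups of order $p^3$ can be embedded, then $|G|=p^6$.
   Context: All groups are finite. A group $K$ can be embedded in a group $G$ if $G$ has a subgroup isomorphic to $K$; "all groups of order $p^3$ can be embedded in $G$" means that every group of order $p^3$ is isomorphic to some subgroup of $G$. *)

theory Defs
  imports "HOL-Algebra.Algebra"
begin

definition embeddable :: "('a, 'c) monoid_scheme \<Rightarrow> ('b, 'd) monoid_scheme \<Rightarrow> bool"
  where "embeddable K G \<longleftrightarrow> (\<exists>S. subgroup S G \<and> K \<cong> G\<lparr>carrier := S\<rparr>)"

(* HOL cannot quantify over types inside a formula, so "all groups of order n" ranges over
   groups whose elements are natural numbers, as does minimality below. For n > 0 this loses
   nothing: see embeds_all_of_orderD and minimal_embedding_groupD. *)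
definition embeds_all_of_order :: "nat \<Rightarrow> ('a, 'c) monoid_scheme \<Rightarrow> bool"
  where "embeds_all_of_order n G \<longleftrightarrow>
    (\<forall>K :: nat monoid. group K \<and> order K = n \<longrightarrow> embeddable K G)"

definition minimal_embedding_group :: "nat \<Rightarrow> ('a, 'c) monoid_scheme \<Rightarrow> bool"
  where "minimal_embedding_group n G \<longleftrightarrow>
    group G \<and> finite (carrier G) \<and> embeds_all_of_order n G \<and>
    (\<forall>H :: nat monoid. group H \<and> finite (carrier H) \<and> embeds_all_of_order n H
       \<longrightarrow> order G \<le> order H)"

lemma finite_group_iso_nat:
  fixes G :: "('a, 'c) monoid_scheme"
  assumes "group G" and "finite (carrier G)"
  shows "\<exists>H :: nat monoid. group H \<and> G \<cong> H"
proof -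
  interpret group G by fact
  obtain f :: "'a \<Rightarrow> nat" where f: "inj_on f (carrier G)"
    using finite_imp_inj_to_nat_seg[OF assms(2)] by blast
  define g where "g = the_inv_into (carrier G) f"
  have g: "g (f x) = x" if "x \<in> carrier G" for x
    using that f by (simp add: g_def the_inv_into_f_f)
  define H :: "nat monoid" where
    "H = \<lparr>carrier = f ` carrier G, monoid.mult = (\<lambda>x y. f (g x \<otimes>\<^bsub>G\<^esub> g y)), monoid.one = f \<one>\<^bsub>G\<^esub>\<rparr>"
  have "group H"
  proof (rule groupI)
    fix x assume "x \<in> carrier H"
    then obtain a where a: "a \<in> carrier G" "x = f a" by (auto simp: H_def)
    then show "\<exists>y\<in>carrier H. y \<otimes>\<^bsub>H\<^esub> x = \<one>\<^bsub>H\<^esub>"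
      by (intro bexI[of _ "f (inv\<^bsub>G\<^esub> a)"]) (auto simp: H_def g)
  qed (auto simp: H_def g m_assoc)
  moreover have "f \<in> iso G H"
    using f by (auto simp: iso_def hom_def H_def g bij_betw_def)
  ultimately show ?thesis using is_isoI by blast
qed

lemma iso_embeddable:
  assumes "K \<cong> L" and "embeddable L G"
  shows "embeddable K G"
  using assms iso_trans unfolding embeddable_def by blast

lemma embeddable_iso:
  assumes "group G" and "group H" and "embeddable K G" and "G \<cong> H"
  shows "embeddable K H"
proof -
  obtain S where S: "subgroup S G" "K \<cong> G\<lparr>carrier := S\<rparr>"
    using assms(3) by (auto simp: embeddable_def)
  obtain h where h: "h \<in> iso G H" using assms(4) by (auto simp: is_iso_def)
  interpret group_hom G H h
    using h assms by (auto simp: group_hom_def group_hom_axioms_def iso_def)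
  have sub: "S \<subseteq> carrier G" using S(1) by (rule subgroup.subset)
  have "inj_on h S" using h sub by (auto simp: iso_def bij_betw_def intro: inj_on_subset)
  then have "h \<in> iso (G\<lparr>carrier := S\<rparr>) (H\<lparr>carrier := h ` S\<rparr>)"
    using sub by (auto simp: iso_def hom_def bij_betw_def subset_iff)
  then have "K \<cong> H\<lparr>carrier := h ` S\<rparr>" using S(2) is_isoI iso_trans by blast
  moreover have "subgroup (h ` S) H" using S(1) by (rule subgroup_img_is_subgroup)
  ultimately show ?thesis by (auto simp: embeddable_def)
qed

lemma embeds_all_of_orderD:
  fixes K :: "('b, 'd) monoid_scheme"
  assumes "embeds_all_of_order n G" and "n > 0" and "group K" and "order K = n"
  shows "embeddable K G"
proof -
  have "finite (carrier K)" using assms(2,4) by (auto simp: order_def intro: card_ge_0_finite)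
  then obtain L :: "nat monoid" where L: "group L" "K \<cong> L"
    using finite_group_iso_nat assms(3) by blast
  then have "order L = n" using iso_same_card[OF L(2)] assms(4) by (simp add: order_def)
  then show ?thesis using L assms(1) iso_embeddable by (auto simp: embeds_all_of_order_def)
qed

lemma minimal_embedding_groupD:
  fixes H :: "('b, 'd) monoid_scheme"
  assumes "minimal_embedding_group n G" and "group H" and "finite (carrier H)"
    and "embeds_all_of_order n H"
  shows "order G \<le> order H"
proof -
  obtain L :: "nat monoid" where L: "group L" "H \<cong> L"
    using finite_group_iso_nat assms(2,3) by blast
  have "embeds_all_of_order n L"
    using assms(2,4) L embeddable_iso unfolding embeds_all_of_order_def by blast
  moreover have "finite (carrier L)" using L(2) assms(3) iso_finite by blast
  moreover have "order L = order H" using iso_same_card[OF L(2)] by (simp add: order_def)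
  ultimately show ?thesis using assms(1) L(1) by (auto simp: minimal_embedding_group_def)
qed

end

theory Submission
  imports Defs
begin

text \<open>
  Write \<open>U\<close> for the group of all \<open>(a, x, y, w)\<close> in \<open>\<int>/p\<^sup>3 \<times> (\<int>/p)\<^sup>3\<close> with product
  \<open>(a + a' + p\<^sup>2 y x', x + x', y + y', w + w')\<close>: the direct product of \<open>\<int>/p\<close> with the central
  product of \<open>\<int>/p\<^sup>3\<close> and the Heisenberg group. It has order \<open>p\<^sup>6\<close> and contains every group of order
  \<open>p\<^sup>3\<close>, and no group whose \<open>p\<close>-part is smaller does.

  For the containment the five isomorphism types need not be listed. A non-cyclic \<open>K\<close> of order \<open>p\<^sup>3\<close>
  has a central element \<open>z\<close> of order \<open>p\<close> such that all \<open>p\<close>-th powers and all commutators are powers of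
  \<open>z\<close> (\<open>central_with_pth_powers\<close>, \<open>commutator_in_central_generate\<close>). Choosing \<open>x\<close> and \<open>y\<close> that
  generate \<open>K\<close> modulo \<open>z\<close>, one has \<open>x\<^sup>p = z\<^sup>\<alpha>\<close>, \<open>y\<^sup>p = z\<^sup>\<beta>\<close>, \<open>y x = x y z\<^sup>\<gamma>\<close>, every element is
  \<open>x\<^sup>i y\<^sup>j z\<^sup>k\<close>, and these words multiply and coincide exactly as the tuples
  \<open>(p \<alpha> i + p \<beta> j + p\<^sup>2 k, i, \<gamma> j, j)\<close> of \<open>U\<close> do. The third coordinate reproduces the commutator, the
  fourth keeps the map injective when \<open>\<gamma> = 0\<close>. This is \<open>noncyclic_embeddable\<close>.

  For the lower bound, Sylow's theorems reduce to a group \<open>P\<close> of order \<open>p\<^sup>n\<close> (\<open>sylow_embeds_all\<close>).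
  Suppose \<open>n \<le> 5\<close>, and let \<open>c\<close> be an element of order \<open>p\<^sup>3\<close> and \<open>E\<close> an elementary abelian subgroup of
  order \<open>p\<^sup>3\<close>. They meet in order at most \<open>p\<close>, so counting forces \<open>n = 5\<close> and \<open>P = E \<langle>c\<rangle>\<close>. If \<open>c\<close> did
  not normalise \<open>E\<close>, the normaliser of \<open>E\<close> would have order \<open>p\<^sup>4\<close> and be the product of the two normal
  subgroups \<open>E\<close> and \<open>c E c\<^sup>-\<^sup>1\<close>; such a product has class at most 2 and, \<open>p\<close> being odd, exponent \<open>p\<close>,
  although it contains \<open>c\<^sup>p\<close>. So \<open>E\<close> is normal. Now \<open>c\<close> acts on \<open>E\<close> as a unipotent matrix of size 3,
  whose \<open>p\<close>-th power is the identity, so \<open>c\<^sup>p\<close> centralises \<open>E\<close>, and it follows that all elements of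
  order \<open>p\<close> lie in \<open>E\<close> (\<open>exponent_p_elements_in_elementary_abelian\<close>). Then the Heisenberg group, being
  of exponent \<open>p\<close> and not commutative, cannot be embedded in \<open>P\<close>.
\<close>


section \<open>Fixed points of actions of groups of prime power order\<close>

text \<open>
  Orbits of a \<open>p\<close>-group have \<open>p\<close>-power size, so the elements that are not fixed come
  in orbits of size divisible by \<open>p\<close>. The action is an ordinary binary function, so that
  conjugation and translation of cosets can be substituted directly.
\<close>
lemma card_fixed_points_dvd:
  fixes S (structure)
  assumes "group S" and ord: "order S = p ^ n" and p: "Factorial_Ring.prime p" and fin: "finite T"
    and closed: "\<And>g x. g \<in> carrier S \<Longrightarrow> x \<in> T \<Longrightarrow> act g x \<in> T"
    and one: "\<And>x. x \<in> T \<Longrightarrow> act \<one> x = x"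
    and mult: "\<And>g h x. g \<in> carrier S \<Longrightarrow> h \<in> carrier S \<Longrightarrow> x \<in> T \<Longrightarrow> act (g \<otimes> h) x = act g (act h x)"
  shows "p dvd card {x \<in> T. \<forall>g\<in>carrier S. act g x = x} \<longleftrightarrow> p dvd card T"
proof -
  interpret group S by fact
  define F where "F = {x \<in> T. \<forall>g\<in>carrier S. act g x = x}"
  define Y where "Y = T - F"
  have Y_closed: "act g x \<in> Y" if g: "g \<in> carrier S" and x: "x \<in> Y" for g x
  proof -
    have xT: "x \<in> T" using x by (simp add: Y_def)
    have "x \<in> F" if F: "act g x \<in> F"
    proof -
      have "act (inv g) (act g x) = act g x" using F g by (simp add: F_def)
      then have "x = act g x"
        using mult[of "inv g" g x] g xT one by simp
      with F show ?thesis by simp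
    qed
    then show ?thesis using x g closed by (auto simp: Y_def)
  qed
  define \<phi> where "\<phi> = (\<lambda>g. \<lambda>x\<in>Y. act g x)"
  have YT: "y \<in> T" if "y \<in> Y" for y using that by (simp add: Y_def)
  have bij: "\<phi> g \<in> Bij Y" if g: "g \<in> carrier S" for g
  proof -
    have "bij_betw (act g) Y Y"
    proof (rule bij_betwI[where g = "act (inv g)"])
      show "act g \<in> Y \<rightarrow> Y" "act (inv g) \<in> Y \<rightarrow> Y"
        using g Y_closed by auto
      show "act (inv g) (act g x) = x" if "x \<in> Y" for x
        using that YT g mult[of "inv g" g x] one by simp
      show "act g (act (inv g) x) = x" if "x \<in> Y" for x
        using that YT g mult[of g "inv g" x] one by simp
    qed
    then have "bij_betw (\<phi> g) Y Y"
      by (subst bij_betw_cong[where g = "act g"]) (auto simp: \<phi>_def)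
    then show ?thesis by (simp add: Bij_def \<phi>_def)
  qed
  have "\<phi> \<in> hom S (BijGroup Y)"
  proof (rule homI)
    fix g h assume gh: "g \<in> carrier S" "h \<in> carrier S"
    have "\<phi> (g \<otimes> h) = compose Y (\<phi> g) (\<phi> h)"
      using gh mult YT Y_closed by (auto simp: \<phi>_def compose_def)
    then show "\<phi> (g \<otimes> h) = \<phi> g \<otimes>\<^bsub>BijGroup Y\<^esub> \<phi> h"
      using gh bij by (simp add: BijGroup_def)
  qed (use bij in \<open>simp add: BijGroup_def\<close>)
  then interpret A: group_action S Y \<phi>
    by (intro group_action.intro group_hom.intro group_BijGroup)
      (simp_all add: group_hom_axioms_def is_group)
  have finY: "finite Y" using fin by (simp add: Y_def)
  have "p dvd card O1" if "O1 \<in> orbits S Y \<phi>" for O1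
  proof -
    obtain x where x: "x \<in> Y" "O1 = orbit S \<phi> x" using \<open>O1 \<in> orbits S Y \<phi>\<close> by (auto simp: orbits_def)
    have "card O1 * card (stabilizer S \<phi> x) = p ^ n"
      using A.orbit_stabilizer_theorem[OF x(1)] x(2) ord by simp
    then have "card O1 dvd p ^ n" by (metis dvd_triv_left)
    then obtain k where k: "card O1 = p ^ k"
      using p by (auto simp: divides_primepow_nat)
    have "k \<noteq> 0"
    proof
      assume "k = 0"
      with k have "card O1 = 1" by simp
      then obtain y where y: "O1 = {y}" by (auto simp: card_1_singleton_iff)
      have "act g x \<in> O1" if "g \<in> carrier S" for g
        using that x by (auto simp: orbit_def \<phi>_def)
      moreover have "x \<in> O1" using A.orbit_refl[OF x(1)] x(2) by simp
      ultimately have "x \<in> F" using y x YT by (auto simp: F_def)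
      then show False using x by (simp add: Y_def)
    qed
    then show ?thesis using k by (simp add: dvd_power)
  qed
  then have "p dvd (\<Sum>O1\<in>orbits S Y \<phi>. \<Sum>x\<in>O1. (1::nat))"
    by (intro dvd_sum[where f = "\<lambda>O1. \<Sum>x\<in>O1. 1"]) simp
  then have "p dvd card Y" using A.disjoint_sum[OF finY, of "\<lambda>_. 1::nat"] by simp
  moreover have "card T = card Y + card F"
  proof -
    have "T = Y \<union> F" "Y \<inter> F = {}" by (auto simp: Y_def F_def)
    moreover have "finite F" using fin by (simp add: F_def)
    ultimately show ?thesis using finY by (simp add: card_Un_disjoint)
  qed
  ultimately show ?thesis by (metis F_def dvd_add_right_iff)
qed

section \<open>Conjugation and commutators\<close>

text \<open>
  This is where odd primes differ from 2: in class 2 the commutator enters a \<open>p\<close>-th power with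
  exponent \<open>p choose 2\<close>.
\<close>
lemma odd_dvd_choose_two:
  fixes p :: nat
  assumes "odd p"
  shows "p dvd p choose 2"
proof -
  obtain m where "p = 2 * m + 1" using assms by (rule oddE)
  then have "p choose 2 = p * m" by (simp add: choose_two)
  then show ?thesis by simp
qed

context group
begin

text \<open>
  Inverses are positive powers, so they need not be checked.
\<close>
lemma finite_subgroupI:
  assumes fin: "finite (carrier G)" and S: "S \<subseteq> carrier G" "a \<in> S"
    and closed: "\<And>x y. x \<in> S \<Longrightarrow> y \<in> S \<Longrightarrow> x \<otimes> y \<in> S"
  shows "subgroup S G"
proof (rule subgroupI)
  fix x assume x: "x \<in> S"
  then have xG: "x \<in> carrier G" using S by blast
  have pow: "x [^] Suc n \<in> S" for n
    by (induction n) (use x xG closed in auto)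
  have "order G > 0" using fin order_gt_0_iff_finite by simp
  then obtain n where n: "order G * 2 = Suc (Suc n)"
    by (cases "order G") auto
  have "x [^] Suc n \<otimes> x = x [^] (order G * 2)" by (simp only: nat_pow_Suc n)
  also have "\<dots> = \<one>" using xG nat_pow_pow[of x "order G" 2] pow_order_eq_1 by simp
  finally have "inv x = x [^] Suc n"
    using xG by (intro inv_equality) simp_all
  then show "inv x \<in> S" using pow by simp
qed (use S closed in blast)+

lemma card_subgroup_dvd:
  assumes "subgroup H G" "subgroup K G" "H \<subseteq> K"
  shows "card H dvd card K"
proof -
  interpret K: group "G\<lparr>carrier := K\<rparr>" using assms(2) by (rule subgroup_imp_group)
  have "subgroup H (G\<lparr>carrier := K\<rparr>)" using assms by (simp add: subgroup_incl)
  from K.lagrange[OF this] have "card K = card (rcosets\<^bsub>G\<lparr>carrier := K\<rparr>\<^esub> H) * card H" by (simp add: order_def)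
  then show ?thesis by simp
qed

lemma card_subgroup_power:
  assumes "order G = p ^ n" "Factorial_Ring.prime p" "subgroup H G"
  obtains k where "k \<le> n" "card H = p ^ k"
proof -
  have "card H dvd p ^ n" using lagrange[OF assms(3)] assms(1) by (metis dvd_triv_right)
  then show ?thesis using that assms(2) by (auto simp: divides_primepow_nat)
qed

lemma conj_group_hom:
  assumes "g \<in> carrier G"
  shows "group_hom G G (\<lambda>x. g \<otimes> x \<otimes> inv g)"
proof -
  have "g \<otimes> (x \<otimes> y) \<otimes> inv g = g \<otimes> x \<otimes> inv g \<otimes> (g \<otimes> y \<otimes> inv g)"
    if "x \<in> carrier G" "y \<in> carrier G" for x y
  proof -
    have "g \<otimes> x \<otimes> inv g \<otimes> (g \<otimes> y \<otimes> inv g) = g \<otimes> x \<otimes> (inv g \<otimes> g) \<otimes> y \<otimes> inv g"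
      using assms that by (simp only: m_assoc m_closed inv_closed)
    then show ?thesis using assms that by (simp add: m_assoc)
  qed
  then show ?thesis
    using assms by (intro group_hom.intro is_group) (auto simp: group_hom_axioms_def hom_def)
qed

lemma conj_mult:
  assumes "g \<in> carrier G" "x \<in> carrier G" "y \<in> carrier G"
  shows "g \<otimes> (x \<otimes> y) \<otimes> inv g = (g \<otimes> x \<otimes> inv g) \<otimes> (g \<otimes> y \<otimes> inv g)"
  using group_hom.hom_mult[OF conj_group_hom[OF assms(1)] assms(2,3)] .

lemma conj_conj:
  assumes "g \<in> carrier G" "h \<in> carrier G" "x \<in> carrier G"
  shows "(g \<otimes> h) \<otimes> x \<otimes> inv (g \<otimes> h) = g \<otimes> (h \<otimes> x \<otimes> inv h) \<otimes> inv g"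
  using assms by (simp add: inv_mult_group m_assoc)

lemma conj_eq_iff:
  assumes "g \<in> carrier G" "x \<in> carrier G" "y \<in> carrier G"
  shows "g \<otimes> x \<otimes> inv g = y \<longleftrightarrow> g \<otimes> x = y \<otimes> g"
  using assms inv_solve_right'[of y "g \<otimes> x" g] by auto

text \<open>
  Conjugation by \<open>y\<close> sends \<open>x\<close> to \<open>x d\<close>; then conjugation by
  \<open>x\<^sup>-\<^sup>i\<close> sends \<open>y\<close> to \<open>y d\<^sup>i\<close>. Both are
  homomorphisms, so no induction over the integer exponents is needed.
\<close>
lemma commutator_int_pow:
  fixes i j :: int
  assumes G: "x \<in> carrier G" "y \<in> carrier G" "d \<in> carrier G"
    and xy: "y \<otimes> x = x \<otimes> y \<otimes> d" and dx: "d \<otimes> x = x \<otimes> d" and dy: "d \<otimes> y = y \<otimes> d"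
  shows "y [^] j \<otimes> x [^] i = x [^] i \<otimes> y [^] j \<otimes> d [^] (i * j)"
proof -
  have comm: "u [^] k \<otimes> v = v \<otimes> u [^] k" if "u \<in> carrier G" "v \<in> carrier G" "u \<otimes> v = v \<otimes> u"
    for u v and k :: int
  proof -
    have "v \<otimes> u \<otimes> inv v = u" using that conj_eq_iff by simp
    then have "v \<otimes> u [^] k \<otimes> inv v = u [^] k"
      using group_hom.hom_int_pow[OF conj_group_hom[of v], of u k] that by simp
    then show ?thesis using that conj_eq_iff by simp
  qed
  have "y \<otimes> x \<otimes> inv y = x \<otimes> d" using G xy dy by (subst conj_eq_iff) (simp_all add: m_assoc)
  then have "y \<otimes> x [^] i \<otimes> inv y = (x \<otimes> d) [^] i"
    using group_hom.hom_int_pow[OF conj_group_hom[of y], of x i] G by simp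
  also have "\<dots> = x [^] i \<otimes> d [^] i" using G dx by (simp add: int_pow_mult_distrib)
  finally have 1: "y \<otimes> x [^] i = x [^] i \<otimes> (y \<otimes> d [^] i)"
    using G comm[OF G(3,2) dy] by (subst (asm) conj_eq_iff) (simp_all add: m_assoc)
  define u where "u = inv (x [^] i)"
  have u: "u \<in> carrier G" "inv u = x [^] i" using G by (auto simp: u_def)
  have yd: "y \<otimes> d [^] i = d [^] i \<otimes> y" using comm[OF G(3,2) dy] by simp
  have "u \<otimes> y \<otimes> inv u = u \<otimes> (x [^] i \<otimes> (y \<otimes> d [^] i))"
    using 1 G u by (simp add: m_assoc)
  also have "\<dots> = y \<otimes> d [^] i" using G by (simp add: u_def m_assoc[symmetric])
  finally have "u \<otimes> y [^] j \<otimes> inv u = (y \<otimes> d [^] i) [^] j"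
    using group_hom.hom_int_pow[OF conj_group_hom[of u], of y j] G u by simp
  also have "\<dots> = y [^] j \<otimes> d [^] (i * j)"
    using G yd comm[OF G(3,2) dy] by (simp add: int_pow_mult_distrib int_pow_pow)
  finally have "u \<otimes> (y [^] j \<otimes> x [^] i) = y [^] j \<otimes> d [^] (i * j)"
    using G u by (simp add: m_assoc)
  then have "inv u \<otimes> (u \<otimes> (y [^] j \<otimes> x [^] i)) = x [^] i \<otimes> (y [^] j \<otimes> d [^] (i * j))"
    using u by simp
  then show ?thesis using G u(1) by (simp add: m_assoc[symmetric])
qed

lemma class_two_power:
  fixes n :: nat
  assumes G: "x \<in> carrier G" "y \<in> carrier G" "d \<in> carrier G"
    and xy: "y \<otimes> x = x \<otimes> y \<otimes> d" and dx: "d \<otimes> x = x \<otimes> d" and dy: "d \<otimes> y = y \<otimes> d"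
  shows "(x \<otimes> y) [^] n = x [^] n \<otimes> y [^] n \<otimes> d [^] (n choose 2)"
proof (induction n)
  case 0
  then show ?case by (simp add: numeral_2_eq_2)
next
  case (Suc n)
  let ?c = "n choose 2"
  have yx: "y [^] n \<otimes> x = x \<otimes> y [^] n \<otimes> d [^] n"
    using commutator_int_pow[OF assms, of "int n" 1] G by (simp add: int_pow_int)
  have d: "d [^] m \<otimes> v = v \<otimes> d [^] m" if "v \<in> {x, y}" for v and m :: nat
    using that dx dy G by (auto simp: group_commutes_pow)
  have d': "d [^] m \<otimes> (v \<otimes> w) = v \<otimes> (d [^] m \<otimes> w)"
    if "v \<in> {x, y}" "w \<in> carrier G" for v w and m :: nat
  proof -
    have v: "v \<in> carrier G" using that G by auto
    have "d [^] m \<otimes> (v \<otimes> w) = d [^] m \<otimes> v \<otimes> w" using that v G by (simp add: m_assoc)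
    also have "\<dots> = v \<otimes> (d [^] m \<otimes> w)" using that v G by (simp only: d[OF that(1)] m_assoc nat_pow_closed)
    finally show ?thesis .
  qed
  have "(x \<otimes> y) [^] Suc n = x [^] n \<otimes> (y [^] n \<otimes> x) \<otimes> (d [^] ?c \<otimes> y)"
    using Suc G by (simp add: m_assoc d')
  also have "\<dots> = x [^] Suc n \<otimes> y [^] Suc n \<otimes> (d [^] n \<otimes> d [^] ?c)"
    using G by (simp add: m_assoc yx d d')
  also have "d [^] n \<otimes> d [^] ?c = d [^] (Suc n choose 2)"
    using G by (simp add: nat_pow_mult numeral_2_eq_2)
  finally show ?case .
qed

end

section \<open>Normalisers and centralisers in groups of prime power order\<close>

definition normaliser :: "('a, 'b) monoid_scheme \<Rightarrow> 'a set \<Rightarrow> 'a set"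
  where "normaliser G H = {g \<in> carrier G. \<forall>h\<in>H. g \<otimes>\<^bsub>G\<^esub> h \<otimes>\<^bsub>G\<^esub> inv\<^bsub>G\<^esub> g \<in> H}"

definition centraliser :: "('a, 'b) monoid_scheme \<Rightarrow> 'a set \<Rightarrow> 'a set"
  where "centraliser G A = {g \<in> carrier G. \<forall>a\<in>A. g \<otimes>\<^bsub>G\<^esub> a = a \<otimes>\<^bsub>G\<^esub> g}"

context group
begin

lemma subgroup_centraliser:
  assumes "finite (carrier G)" "A \<subseteq> carrier G"
  shows "subgroup (centraliser G A) G"
proof (rule finite_subgroupI[OF assms(1)])
  show "\<one> \<in> centraliser G A" using assms by (auto simp: centraliser_def)
  fix x y assume xy: "x \<in> centraliser G A" "y \<in> centraliser G A"
  have "x \<otimes> y \<otimes> a = a \<otimes> (x \<otimes> y)" if "a \<in> A" for a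
  proof -
    have aG: "a \<in> carrier G" "x \<in> carrier G" "y \<in> carrier G"
      and c: "y \<otimes> a = a \<otimes> y" "x \<otimes> a = a \<otimes> x"
      using that assms xy by (auto simp: centraliser_def)
    have "x \<otimes> y \<otimes> a = x \<otimes> a \<otimes> y" using aG c(1) by (simp add: m_assoc)
    then show ?thesis using aG c(2) by (simp add: m_assoc)
  qed
  then show "x \<otimes> y \<in> centraliser G A" using xy by (auto simp: centraliser_def)
qed (auto simp: centraliser_def)

lemma subgroup_normaliser:
  assumes "finite (carrier G)" "subgroup H G"
  shows "subgroup (normaliser G H) G"
proof (rule finite_subgroupI[OF assms(1)])
  show "\<one> \<in> normaliser G H"
    using subgroup.mem_carrier[OF assms(2)] by (auto simp: normaliser_def)
  fix x y assume xy: "x \<in> normaliser G H" "y \<in> normaliser G H"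
  then have "x \<otimes> y \<otimes> h \<otimes> inv (x \<otimes> y) \<in> H" if "h \<in> H" for h
    using that conj_conj[of x y h] subgroup.mem_carrier[OF assms(2)] by (auto simp: normaliser_def)
  then show "x \<otimes> y \<in> normaliser G H" using xy by (auto simp: normaliser_def)
qed (auto simp: normaliser_def)

lemma subset_normaliser:
  assumes "subgroup H G"
  shows "H \<subseteq> normaliser G H"
proof -
  interpret subgroup H G by fact
  show ?thesis by (auto simp: normaliser_def)
qed

text \<open>
  The subgroup \<open>S\<close> acts on the right cosets of \<open>H\<close> by right translation. A fixed
  coset \<open>H g\<close> says that \<open>g\<close> conjugates \<open>S\<close> into \<open>H\<close>; with
  this, the same count yields both the growth of normalisers (\<open>S = H\<close>) and the conjugacy part of
  the Sylow theorems (\<open>H\<close> a Sylow subgroup).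
\<close>
lemma card_fixed_cosets_dvd:
  assumes fin: "finite (carrier G)" and p: "Factorial_Ring.prime p"
    and S: "subgroup S G" "card S = p ^ k" and H: "subgroup H G"
  shows "p dvd card {T \<in> rcosets H. \<forall>s\<in>S. T #> inv s = T} \<longleftrightarrow> p dvd card (rcosets H)"
proof -
  have HG: "H \<subseteq> carrier G" using H by (rule subgroup.subset)
  have SG: "s \<in> carrier G" if "s \<in> S" for s using that S(1) by (rule subgroup.mem_carrier[rotated])
  have TG: "T \<subseteq> carrier G" if "T \<in> rcosets H" for T
    using that H by (simp add: subgroup.rcosets_carrier is_group)
  have "p dvd card {T \<in> rcosets H. \<forall>s\<in>carrier (G\<lparr>carrier := S\<rparr>). T #> inv s = T}
      \<longleftrightarrow> p dvd card (rcosets H)"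
  proof (rule card_fixed_points_dvd[where n = k])
    show "Group.group (G\<lparr>carrier := S\<rparr>)" using S(1) by (rule subgroup_imp_group)
    show "order (G\<lparr>carrier := S\<rparr>) = p ^ k" using S(2) by (simp add: order_def)
    show "finite (rcosets H)" using fin HG by (simp add: RCOSETS_def)
    show "T #> inv s \<in> rcosets H" if "s \<in> carrier (G\<lparr>carrier := S\<rparr>)" "T \<in> rcosets H" for s T
    proof -
      obtain a where a: "a \<in> carrier G" "T = H #> a" using \<open>T \<in> rcosets H\<close> by (auto simp: RCOSETS_def)
      then show ?thesis using \<open>s \<in> _\<close> SG HG by (simp add: coset_mult_assoc rcosetsI)
    qed
    show "T #> inv \<one>\<^bsub>G\<lparr>carrier := S\<rparr>\<^esub> = T" if "T \<in> rcosets H" for T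
      using TG[OF that] by simp
    show "T #> inv (s \<otimes>\<^bsub>G\<lparr>carrier := S\<rparr>\<^esub> t) = T #> inv t #> inv s"
      if "s \<in> carrier (G\<lparr>carrier := S\<rparr>)" "t \<in> carrier (G\<lparr>carrier := S\<rparr>)" "T \<in> rcosets H" for s t T
      using that SG TG by (simp add: coset_mult_assoc inv_mult_group)
  qed (fact p)
  then show ?thesis by simp
qed

lemma fixed_coset_conj:
  assumes H: "subgroup H G" and g: "g \<in> carrier G" and s: "s \<in> carrier G"
    and fixed: "H #> g #> inv s = H #> g"
  shows "g \<otimes> s \<otimes> inv g \<in> H"
proof -
  have HG: "H \<subseteq> carrier G" using H by (rule subgroup.subset)
  have "g \<in> H #> (g \<otimes> inv s)"
    using rcos_self[OF g H] fixed g s HG by (simp add: coset_mult_assoc)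
  then obtain h where h: "h \<in> H" "g = h \<otimes> (g \<otimes> inv s)" by (auto simp: r_coset_def)
  then have hG: "h \<in> carrier G" using HG by blast
  have "g \<otimes> s = h \<otimes> g \<otimes> (inv s \<otimes> s)"
    by (subst h(2)) (use g s hG in \<open>simp only: m_assoc m_closed inv_closed\<close>)
  then have "g \<otimes> s = h \<otimes> g" using g s hG by simp
  then have "g \<otimes> s \<otimes> inv g = h" using g s hG by (subst conj_eq_iff)
  then show ?thesis using h by simp
qed

lemma p_subgroup_conj_into:
  assumes fin: "finite (carrier G)" and p: "Factorial_Ring.prime p"
    and S: "subgroup S G" "card S = p ^ k" and H: "subgroup H G"
    and index: "\<not> p dvd card (rcosets H)"
  obtains g where "g \<in> carrier G" "\<And>s. s \<in> S \<Longrightarrow> g \<otimes> s \<otimes> inv g \<in> H"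
proof -
  have "{T \<in> rcosets H. \<forall>s\<in>S. T #> inv s = T} \<noteq> {}"
    using card_fixed_cosets_dvd[OF fin p S H] index by (metis card.empty dvd_0_right)
  then obtain g where "g \<in> carrier G" "\<forall>s\<in>S. H #> g #> inv s = H #> g"
    by (auto simp: RCOSETS_def)
  then show ?thesis
    using that fixed_coset_conj[OF H] subgroup.mem_carrier[OF S(1)] by blast
qed

lemma card_psubset_subgroup:
  assumes "order G = p ^ n" "Factorial_Ring.prime p" "subgroup H G" "subgroup K G" "H \<subset> K"
  shows "p * card H \<le> card K"
proof -
  obtain i where i: "card H = p ^ i" using card_subgroup_power[OF assms(1-3)] .
  obtain j where j: "card K = p ^ j" using card_subgroup_power[OF assms(1,2,4)] .
  have p: "p > 1" using assms(2) by (rule prime_gt_1_nat)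
  then have "finite K" using j by (intro card_ge_0_finite) simp
  then have "p ^ i < p ^ j" using i j assms(5) by (metis psubset_card_mono)
  then have "i < j" using p by simp
  then have "p ^ Suc i \<le> p ^ j" using p by (intro power_increasing) simp_all
  then show ?thesis using i j by simp
qed

text \<open>
  The subgroup \<open>H\<close> fixes its own coset, and the number of cosets that it fixes is divisible by
  \<open>p\<close>, so it fixes a further coset \<open>H g\<close>, which puts \<open>g\<close> into the
  normaliser.
\<close>
lemma normaliser_grows:
  assumes ord: "order G = p ^ n" and p: "Factorial_Ring.prime p"
    and H: "subgroup H G" "H \<noteq> carrier G"
  shows "H \<subset> normaliser G H"
proof -
  have p1: "p > 1" using p by (rule prime_gt_1_nat)
  have fin: "finite (carrier G)" using ord p1 order_gt_0_iff_finite by simp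
  have HG: "H \<subset> carrier G" using H subgroup.subset by blast
  obtain k where k: "card H = p ^ k" using card_subgroup_power[OF ord p H(1)] .
  have "p * card H \<le> order G"
    using card_psubset_subgroup[OF ord p H(1) subgroup_self HG] by (simp add: order_def)
  then have "p * card H \<le> card (rcosets H) * card H" using lagrange[OF H(1)] by simp
  then have "card (rcosets H) \<noteq> 1" using p1 k by simp
  moreover have "card (rcosets H) dvd p ^ n" using lagrange[OF H(1)] ord by (metis dvd_triv_left)
  ultimately have "p dvd card (rcosets H)"
    using p by (auto simp: divides_primepow_nat intro!: dvd_power)
  then have dvd: "p dvd card {T \<in> rcosets H. \<forall>s\<in>H. T #> inv s = T}" (is "p dvd card ?F")
    using card_fixed_cosets_dvd[OF fin p H(1) k H(1)] by simp
  have HF: "H \<in> ?F"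
    using H(1) by (simp add: subgroup.subgroup_in_rcosets subgroup.rcos_const is_group subgroup.m_inv_closed)
  have "?F \<noteq> {H}" using dvd p1 by auto
  then obtain T where T: "T \<in> ?F" "T \<noteq> H" using HF by blast
  then obtain g where g: "g \<in> carrier G" "T = H #> g" by (auto simp: RCOSETS_def)
  have "g \<notin> H"
    using subgroup.rcos_const[OF H(1) is_group, of g] T(2) g(2) by auto
  moreover have "g \<otimes> h \<otimes> inv g \<in> H" if "h \<in> H" for h
    using fixed_coset_conj[OF H(1) g(1) subgroup.mem_carrier[OF H(1) that]] T(1) g(2) that by blast
  then have "g \<in> normaliser G H" using g(1) by (simp add: normaliser_def)
  ultimately show ?thesis using subset_normaliser[OF H(1)] by blast
qed

lemma card_conj_fixed_dvd:
  assumes fin: "finite (carrier G)" and p: "Factorial_Ring.prime p"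
    and S: "subgroup S G" "card S = p ^ k" and T: "T \<subseteq> carrier G"
    and closed: "\<And>s t. s \<in> S \<Longrightarrow> t \<in> T \<Longrightarrow> s \<otimes> t \<otimes> inv s \<in> T"
  shows "p dvd card {t \<in> T. \<forall>s\<in>S. s \<otimes> t \<otimes> inv s = t} \<longleftrightarrow> p dvd card T"
proof -
  have SG: "s \<in> carrier G" if "s \<in> S" for s using that S(1) by (rule subgroup.mem_carrier[rotated])
  have "p dvd card {t \<in> T. \<forall>s\<in>carrier (G\<lparr>carrier := S\<rparr>). s \<otimes> t \<otimes> inv s = t} \<longleftrightarrow> p dvd card T"
  proof (rule card_fixed_points_dvd[where n = k])
    show "Group.group (G\<lparr>carrier := S\<rparr>)" using S(1) by (rule subgroup_imp_group)
    show "order (G\<lparr>carrier := S\<rparr>) = p ^ k" using S(2) by (simp add: order_def)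
    show "finite T" using fin T by (rule finite_subset[rotated])
  qed (use T closed SG p in \<open>auto simp: conj_conj subset_iff\<close>)
  then show ?thesis by simp
qed

lemma central_element_of_prime_order:
  assumes ord: "order G = p ^ n" and p: "Factorial_Ring.prime p" and n: "n > 0"
  obtains z where "z \<in> centraliser G (carrier G)" "ord z = p"
proof -
  have p1: "p > 1" using p by (rule prime_gt_1_nat)
  have fin: "finite (carrier G)" using ord p1 order_gt_0_iff_finite by simp
  let ?Z = "centraliser G (carrier G)"
  have Z: "subgroup ?Z G" using fin by (intro subgroup_centraliser) simp_all
  have "?Z = {t \<in> carrier G. \<forall>s\<in>carrier G. s \<otimes> t \<otimes> inv s = t}"
    by (auto simp: centraliser_def conj_eq_iff)
  moreover have "p dvd card (carrier G)" using ord n by (simp add: order_def dvd_power)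
  ultimately have dvd: "p dvd card ?Z"
    using card_conj_fixed_dvd[OF fin p subgroup_self, of n "carrier G"] ord by (simp add: order_def)
  have "\<one> \<in> ?Z" using Z by (rule subgroup.one_closed)
  moreover have "?Z \<noteq> {\<one>}" using dvd p1 by auto
  ultimately obtain w where w: "w \<in> ?Z" "w \<noteq> \<one>" by blast
  have wG: "w \<in> carrier G" using w by (simp add: centraliser_def)
  have "ord w dvd p ^ n" using ord_dvd_group_order[OF wG] ord by simp
  then obtain m where m: "ord w = p ^ m" using p by (auto simp: divides_primepow_nat)
  with w wG have "m \<noteq> 0" using ord_eq_1 by (metis power_0)
  then obtain l where l: "m = Suc l" by (cases m) auto
  have "ord (w [^] (p ^ l)) = p"
    using ord_pow[OF wG, of "p ^ l"] m l p1 by (simp add: mult.commute)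
  moreover have "w [^] (p ^ l) \<in> ?Z"
    using w wG by (auto simp: centraliser_def group_commutes_pow)
  ultimately show ?thesis using that by blast
qed

text \<open>
  The centraliser of a non-central element would lie strictly above the non-trivial centre, hence be the whole
  group.
\<close>
lemma order_prime_squared_comm:
  assumes ord: "order G = p ^ 2" and p: "Factorial_Ring.prime p"
    and xy: "x \<in> carrier G" "y \<in> carrier G"
  shows "x \<otimes> y = y \<otimes> x"
proof -
  have p1: "p > 1" using p by (rule prime_gt_1_nat)
  have fin: "finite (carrier G)" using ord p1 order_gt_0_iff_finite by simp
  let ?Z = "centraliser G (carrier G)" and ?C = "centraliser G {x}"
  have Z: "subgroup ?Z G" using fin by (intro subgroup_centraliser) simp_all
  have C: "subgroup ?C G" using fin xy by (intro subgroup_centraliser) simp_all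
  obtain z where z: "z \<in> ?Z" "ord z = p" using central_element_of_prime_order[OF ord p] by auto
  have "{\<one>} \<subset> ?Z"
  proof -
    have "z \<noteq> \<one>" using z p1 by auto
    then show ?thesis using z(1) subgroup.one_closed[OF Z] by blast
  qed
  then have "p \<le> card ?Z" using card_psubset_subgroup[OF ord p triv_subgroup Z] by simp
  show ?thesis
  proof (cases "x \<in> ?Z")
    case True
    then show ?thesis using xy by (simp add: centraliser_def)
  next
    case False
    moreover have "?Z \<subseteq> ?C" "x \<in> ?C" using xy by (auto simp: centraliser_def)
    ultimately have "?Z \<subset> ?C" by blast
    then have "p * card ?Z \<le> card ?C" by (rule card_psubset_subgroup[OF ord p Z C])
    with \<open>p \<le> card ?Z\<close> have "p * p \<le> card ?C" by (meson le_trans mult_le_mono2)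
    then have "?C = carrier G"
      using subgroup.subset[OF C] fin ord by (intro card_seteq) (simp_all add: order_def power2_eq_square)
    then have "y \<in> ?C" using xy by simp
    then show ?thesis by (simp add: centraliser_def)
  qed
qed

end

section \<open>Elementary abelian subgroups of order \<open>p\<^sup>3\<close> in groups of order at most \<open>p\<^sup>5\<close>\<close>

context group
begin

lemma mult_cancel_inv:
  assumes "x \<in> carrier G" "w \<in> carrier G"
  shows "inv x \<otimes> (x \<otimes> w) = w" "x \<otimes> (inv x \<otimes> w) = w"
  using assms by (simp_all add: m_assoc[symmetric])

lemma pow_index_mem:
  assumes "N \<lhd> G" "g \<in> carrier G"
  shows "g [^] card (rcosets N) \<in> N"
proof -
  interpret N: normal N G by fact
  interpret Q: group "G Mod N" by (rule N.factorgroup_is_group)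
  have "N #> g \<in> carrier (G Mod N)" using assms(2) by (auto simp: carrier_FactGroup)
  then have "(N #> g) [^]\<^bsub>G Mod N\<^esub> order (G Mod N) = \<one>\<^bsub>G Mod N\<^esub>" by (rule Q.pow_order_eq_1)
  then have "N #> (g [^] order (G Mod N)) = N"
    using assms(2) by (simp add: N.FactGroup_pow )
  then have "g [^] order (G Mod N) \<in> N"
    using rcos_self[OF nat_pow_closed[OF assms(2)] N.subgroup_axioms, of "order (G Mod N)"] by simp
  then show ?thesis by (simp add: order_def FactGroup_def)
qed

definition commutators :: "'a \<Rightarrow> 'a set \<Rightarrow> 'a set"
  where "commutators c I = (\<lambda>x. c \<otimes> x \<otimes> inv c \<otimes> inv x) ` I"

text \<open>
  On an abelian \<open>I\<close> the map \<open>x \<mapsto> [c, x]\<close> is an endomorphism whose kernel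
  consists of the fixed points of \<open>c\<close>. If \<open>I\<close> is non-trivial, so is this kernel,
  because \<open>c\<close> has \<open>p\<close>-power order. In additive terms the endomorphism is \<open>c -
  1\<close>, and iterating the lemma shows that it is nilpotent.
\<close>
lemma commutators_shrink:
  assumes ord: "order G = p ^ n" and p: "Factorial_Ring.prime p"
    and I: "subgroup I G" and comm: "\<And>x y. x \<in> I \<Longrightarrow> y \<in> I \<Longrightarrow> x \<otimes> y = y \<otimes> x"
    and c: "c \<in> normaliser G I"
  shows "subgroup (commutators c I) G" "commutators c I \<subseteq> I" "c \<in> normaliser G (commutators c I)"
    and "card I \<le> p ^ Suc k \<Longrightarrow> card (commutators c I) \<le> p ^ k"
proof -
  have p1: "p > 1" using p by (rule prime_gt_1_nat)
  have fin: "finite (carrier G)" using ord p1 order_gt_0_iff_finite by simp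
  interpret I: subgroup I G by fact
  interpret GI: group "G\<lparr>carrier := I\<rparr>" using I by (rule subgroup_imp_group)
  have cG: "c \<in> carrier G" and cI: "\<And>x. x \<in> I \<Longrightarrow> c \<otimes> x \<otimes> inv c \<in> I"
    using c by (auto simp: normaliser_def)
  define f where "f = (\<lambda>x. c \<otimes> x \<otimes> inv c \<otimes> inv x)"
  have fI: "f x \<in> I" if "x \<in> I" for x using that cI by (simp add: f_def)
  have f_mult: "f (x \<otimes> y) = f x \<otimes> f y" if x: "x \<in> I" and y: "y \<in> I" for x y
  proof -
    define u v where "u = c \<otimes> x \<otimes> inv c" and "v = c \<otimes> y \<otimes> inv c"
    have uv: "u \<in> I" "v \<in> I" using cI x y by (auto simp: u_def v_def)
    have "f (x \<otimes> y) = u \<otimes> v \<otimes> inv (x \<otimes> y)" using x y cG by (simp add: f_def u_def v_def conj_mult)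
    also have "inv (x \<otimes> y) = inv x \<otimes> inv y" 
      using comm[OF x y] x y inv_mult_group[of y x] by simp
    also have "u \<otimes> v \<otimes> (inv x \<otimes> inv y) = u \<otimes> (v \<otimes> inv x) \<otimes> inv y" using uv x y by (simp add: m_assoc)
    also have "v \<otimes> inv x = inv x \<otimes> v" using uv x by (intro comm) auto
    also have "u \<otimes> (inv x \<otimes> v) \<otimes> inv y = f x \<otimes> f y"
      using uv x y by (simp add: f_def u_def[symmetric] v_def[symmetric] m_assoc)
    finally show ?thesis .
  qed
  have img: "commutators c I = f ` I" by (simp add: commutators_def f_def)
  show sub: "commutators c I \<subseteq> I" using fI img by auto
  show sg: "subgroup (commutators c I) G"
  proof (rule finite_subgroupI[OF fin, where a = "f \<one>"])
    show "commutators c I \<subseteq> carrier G" using sub I.subset by blast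
    show "f \<one> \<in> commutators c I" using img by simp
    fix x y assume "x \<in> commutators c I" "y \<in> commutators c I"
    then obtain a b where "a \<in> I" "b \<in> I" "x = f a" "y = f b" by (auto simp: img)
    then show "x \<otimes> y \<in> commutators c I" using f_mult[of a b, symmetric] I.m_closed[of a b] by (simp add: img)
  qed
  interpret f: group_hom "G\<lparr>carrier := I\<rparr>" "G\<lparr>carrier := f ` I\<rparr>" f
    using subgroup_imp_group[OF sg]
    by (intro group_hom.intro GI.is_group) (auto simp: group_hom_axioms_def hom_def f_mult img)
  show "c \<in> normaliser G (commutators c I)"
  proof -
    have "c \<otimes> f x \<otimes> inv c = f (c \<otimes> x \<otimes> inv c)" if "x \<in> I" for x
      using that cG by (simp add: f_def inv_mult_group m_assoc mult_cancel_inv)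
    then show ?thesis using cG cI by (auto simp: normaliser_def img)
  qed
  assume le: "card I \<le> p ^ Suc k"
  show "card (commutators c I) \<le> p ^ k"
  proof (cases "I = {\<one>}")
    case True
    then have "f ` I = {f \<one>}" by simp
    then show ?thesis using p1 by (simp add: img)
  next
    case False
    let ?K = "kernel (G\<lparr>carrier := I\<rparr>) (G\<lparr>carrier := f ` I\<rparr>) f" and ?C = "generate G {c}"
    have C: "subgroup ?C G" using cG by (intro generate_is_subgroup) simp
    obtain j where j: "card ?C = p ^ j" using card_subgroup_power[OF ord p C] .
    have K_fixed: "?K = {t \<in> I. \<forall>s\<in>?C. s \<otimes> t \<otimes> inv s = t}"
    proof -
      have "t \<in> ?K \<longleftrightarrow> c \<otimes> t = t \<otimes> c" if t: "t \<in> I" for t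
      proof -
        have "t \<in> ?K \<longleftrightarrow> c \<otimes> t \<otimes> inv c \<otimes> inv t = \<one>" using t by (simp add: kernel_def f_def)
        also have "\<dots> \<longleftrightarrow> c \<otimes> t \<otimes> inv c = t"
          using inv_solve_right'[of \<one> "c \<otimes> t \<otimes> inv c" t] t cG by auto
        also have "\<dots> \<longleftrightarrow> c \<otimes> t = t \<otimes> c" using t cG by (intro conj_eq_iff) auto
        finally show ?thesis .
      qed
      moreover have "s \<otimes> t \<otimes> inv s = t" if t: "t \<in> I" and ct: "c \<otimes> t = t \<otimes> c" and s: "s \<in> ?C" for s t
      proof -
        have "subgroup (centraliser G {t}) G" using t fin by (intro subgroup_centraliser) auto
        moreover have "c \<in> centraliser G {t}" using ct cG by (simp add: centraliser_def)
        ultimately have "s \<in> centraliser G {t}"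
          using s generate_subgroup_incl[of "{c}" "centraliser G {t}"] by blast
        then show ?thesis using t by (subst conj_eq_iff) (auto simp: centraliser_def)
      qed
      moreover have "c \<otimes> t = t \<otimes> c" if "t \<in> I" "\<forall>s\<in>?C. s \<otimes> t \<otimes> inv s = t" for t
        using that cG generate.incl[of c "{c}"] conj_eq_iff[of c t t] by auto
      ultimately show ?thesis by (auto simp: kernel_def)
    qed
    have p_dvd: "p dvd card I"
    proof -
      obtain i where i: "card I = p ^ i" using card_subgroup_power[OF ord p I] .
      have "i \<noteq> 0"
      proof
        assume "i = 0"
        then obtain a where "I = {a}" using i by (auto simp: card_1_singleton_iff)
        then show False using False I.one_closed by simp
      qed
      then show ?thesis using i by (simp add: dvd_power)
    qed
    have closed: "s \<otimes> t \<otimes> inv s \<in> I" if "s \<in> ?C" "t \<in> I" for s t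
    proof -
      have "?C \<subseteq> normaliser G I"
        using c by (intro generate_subgroup_incl subgroup_normaliser fin I) simp
      then show ?thesis using that by (auto simp: normaliser_def)
    qed
    have "p dvd card ?K"
      unfolding K_fixed using p_dvd by (subst card_conj_fixed_dvd[OF fin p C j I.subset closed])
    have K: "subgroup ?K (G\<lparr>carrier := I\<rparr>)" by (rule f.subgroup_kernel)
    have "finite ?K" using finite_subset[OF I.subset fin] by (simp add: kernel_def)
    then have "card ?K > 0" using subgroup.one_closed[OF K] by (auto simp: card_gt_0_iff)
    with \<open>p dvd card ?K\<close> have p_le: "p \<le> card ?K" by (rule dvd_imp_le)
    have "bij_betw (\<lambda>T. the_elem (f ` T)) (carrier (G\<lparr>carrier := I\<rparr> Mod ?K)) (f ` I)"
      using f.FactGroup_iso_set by (simp add: iso_def)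
    then have "card (rcosets\<^bsub>G\<lparr>carrier := I\<rparr>\<^esub> ?K) = card (f ` I)"
      using bij_betw_same_card by (auto simp: FactGroup_def)
    then have "card (f ` I) * p \<le> card I"
      using GI.lagrange[OF K] mult_le_mono2[OF p_le, of "card (f ` I)"] by (simp add: order_def)
    then have "card (f ` I) * p \<le> p ^ Suc k" using le by (rule order_trans)
    then have "p * card (f ` I) \<le> p * p ^ k" by (simp add: mult.commute)
    then show ?thesis using p1 img by simp
  qed
qed

text \<open>
  Additively, \<open>c = 1 + N\<close> on \<open>E\<close> with \<open>N\<^sup>3 = 0\<close>, so
  \<open>c\<^sup>p = 1 + p N + (p choose 2) N\<^sup>2 = 1\<close>, as \<open>p\<close> divides both
  coefficients and \<open>E\<close> has exponent \<open>p\<close>.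
\<close>
lemma prime_power_centralises:
  assumes ord: "order G = p ^ n" and p: "Factorial_Ring.prime p" and odd: "odd p"
    and E: "subgroup E G" "card E = p ^ 3" "\<And>x y. x \<in> E \<Longrightarrow> y \<in> E \<Longrightarrow> x \<otimes> y = y \<otimes> x"
      "\<And>x. x \<in> E \<Longrightarrow> x [^] p = \<one>"
    and c: "c \<in> normaliser G E" and x: "x \<in> E"
  shows "c [^] p \<otimes> x = x \<otimes> c [^] p"
proof -
  let ?E1 = "commutators c E" and ?f = "\<lambda>x. c \<otimes> x \<otimes> inv c \<otimes> inv x"
  let ?E2 = "commutators c ?E1"
  let ?E3 = "commutators c ?E2"
  have fin: "finite (carrier G)" using ord prime_gt_0_nat[OF p] order_gt_0_iff_finite by simp
  have cG: "c \<in> carrier G" using c by (simp add: normaliser_def)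
  have EG: "e \<in> carrier G" if "e \<in> E" for e using that E(1) by (rule subgroup.mem_carrier[rotated])
  note s1 = commutators_shrink[OF ord p E(1,3) c]
  have c1: "card ?E1 \<le> p ^ 2" using s1(4)[of 2] E(2) by simp
  have comm1: "u \<otimes> v = v \<otimes> u" if "u \<in> ?E1" "v \<in> ?E1" for u v using that s1(2) E(3) by blast
  note s2 = commutators_shrink[OF ord p s1(1) comm1 s1(3)]
  have c2: "card ?E2 \<le> p ^ 1" using s2(4)[of 1] c1 by (simp add: numeral_2_eq_2)
  have comm2: "u \<otimes> v = v \<otimes> u" if "u \<in> ?E2" "v \<in> ?E2" for u v using that s2(2) comm1 by blast
  note s3 = commutators_shrink[OF ord p s2(1) comm2 s2(3)]
  have "card ?E3 \<le> 1" using s3(4)[of 0] c2 by simp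
  moreover have "finite ?E3" using subgroup.subset[OF s3(1)] fin by (rule finite_subset)
  ultimately have E3: "y = \<one>" if "y \<in> ?E3" for y
    using that subgroup.one_closed[OF s3(1)] by (auto simp: card_le_Suc0_iff_eq)
  \<comment> \<open>In additive notation \<open>x1 = N x\<close> and \<open>x2 = N\<^sup>2 x\<close>, while \<open>N\<^sup>3 x = 0\<close>.\<close>
  define x1 where "x1 = ?f x"
  define x2 where "x2 = ?f x1"
  have "x1 \<in> ?E1" "x2 \<in> ?E2" "?f x2 \<in> ?E3" using x by (auto simp: commutators_def x1_def x2_def)
  then have xE: "x1 \<in> E" "x2 \<in> E" and fx2: "?f x2 = \<one>" using E3 s1(2) s2(2) by auto
  have conj: "c \<otimes> y \<otimes> inv c = ?f y \<otimes> y" if "y \<in> E" for y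
    using EG[OF that] cG by (simp add: m_assoc)
  have conj0: "c \<otimes> x \<otimes> inv c = x1 \<otimes> x" unfolding x1_def by (rule conj[OF x])
  have conj1: "c \<otimes> x1 \<otimes> inv c = x2 \<otimes> x1" unfolding x2_def by (rule conj[OF xE(1)])
  have conj2: "c \<otimes> x2 \<otimes> inv c = x2" using conj[OF xE(2)] fx2 EG[OF xE(2)] by simp
  have G: "x \<in> carrier G" "x1 \<in> carrier G" "x2 \<in> carrier G" using EG x xE by auto
  interpret h: group_hom G G "\<lambda>y. c \<otimes> y \<otimes> inv c" using cG by (rule conj_group_hom)
  have powE: "y [^] k \<in> E" if "y \<in> E" for y and k :: nat
    by (induction k) (use that E(1) in \<open>simp_all add: subgroup.one_closed subgroup.m_closed\<close>)
  have formula: "c [^] k \<otimes> x \<otimes> inv (c [^] k) = x \<otimes> x1 [^] k \<otimes> x2 [^] (k choose 2)" for k :: nat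
  proof (induction k)
    case 0
    then show ?case using G by (simp add: numeral_2_eq_2)
  next
    case (Suc k)
    let ?m = "k choose 2"
    have "c [^] Suc k = c \<otimes> c [^] k" using cG nat_pow_Suc2 by simp
    then have "c [^] Suc k \<otimes> x \<otimes> inv (c [^] Suc k) = c \<otimes> (c [^] k \<otimes> x \<otimes> inv (c [^] k)) \<otimes> inv c"
      using conj_conj[of c "c [^] k" x] G cG by simp
    also have "\<dots> = (c \<otimes> x \<otimes> inv c) \<otimes> (c \<otimes> x1 \<otimes> inv c) [^] k \<otimes> (c \<otimes> x2 \<otimes> inv c) [^] ?m"
      unfolding Suc using G by (simp only: h.hom_mult h.hom_nat_pow m_closed nat_pow_closed)
    also have "\<dots> = (x1 \<otimes> x) \<otimes> (x2 [^] k \<otimes> x1 [^] k) \<otimes> x2 [^] ?m"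
      unfolding conj0 conj1 conj2 pow_mult_distrib[OF E(3)[OF xE(2,1)] G(3,2)] ..
    also have "x1 \<otimes> x = x \<otimes> x1" using E(3) xE x by blast
    also have "x2 [^] k \<otimes> x1 [^] k = x1 [^] k \<otimes> x2 [^] k" using E(3) powE xE by blast
    also have "x \<otimes> x1 \<otimes> (x1 [^] k \<otimes> x2 [^] k) \<otimes> x2 [^] ?m = x \<otimes> (x1 \<otimes> x1 [^] k) \<otimes> (x2 [^] k \<otimes> x2 [^] ?m)"
      using G by (simp add: m_assoc)
    also have "x1 \<otimes> x1 [^] k = x1 [^] Suc k" using G nat_pow_Suc2 by simp
    also have "x2 [^] k \<otimes> x2 [^] ?m = x2 [^] (Suc k choose 2)"
      using G by (simp add: nat_pow_mult numeral_2_eq_2)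
    finally show ?case .
  qed
  obtain m where m: "p choose 2 = p * m" using odd_dvd_choose_two[OF odd] by blast
  have "x2 [^] (p choose 2) = \<one>"
    using nat_pow_pow[OF G(3), of p m] E(4)[OF xE(2)] m by simp
  then have "c [^] p \<otimes> x \<otimes> inv (c [^] p) = x"
    using formula[of p] E(4)[OF xE(1)] G by simp
  then show ?thesis using conj_eq_iff[of "c [^] p" x x] cG G by simp
qed

text \<open>
  Otherwise the normaliser \<open>N\<close> of \<open>E\<close> has order \<open>p\<^sup>4\<close> and is
  normal, so it contains \<open>c\<^sup>p\<close> and a second copy \<open>F = c E c\<^sup>-\<^sup>1\<close>
  of \<open>E\<close>. Both are normal in \<open>N\<close>, so \<open>N = E F\<close>, and \<open>[F,
  E]\<close> lies in \<open>E \<inter> F\<close>, which is central in \<open>N\<close>. Hence \<open>N\<close>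
  has exponent \<open>p\<close>, contradicting \<open>c\<^sup>p \<in> N\<close>.
\<close>
lemma normalises_elementary_abelian:
  assumes ord: "order G = p ^ 5" and p: "Factorial_Ring.prime p" and odd: "odd p"
    and E: "subgroup E G" "card E = p ^ 3" "\<And>x y. x \<in> E \<Longrightarrow> y \<in> E \<Longrightarrow> x \<otimes> y = y \<otimes> x"
      "\<And>x. x \<in> E \<Longrightarrow> x [^] p = \<one>"
    and c: "c \<in> carrier G" "c [^] (p ^ 2) \<noteq> \<one>"
  shows "c \<in> normaliser G E"
proof (rule ccontr)
  assume cN: "c \<notin> normaliser G E"
  define N where "N = normaliser G E"
  have p1: "p > 1" using p by (rule prime_gt_1_nat)
  have fin: "finite (carrier G)" using ord p1 order_gt_0_iff_finite by simp
  have EG: "e \<in> carrier G" if "e \<in> E" for e using that E(1) by (rule subgroup.mem_carrier[rotated])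
  have N: "subgroup N G" unfolding N_def using fin E(1) by (rule subgroup_normaliser)
  interpret N: subgroup N G by fact
  have EN: "E \<subseteq> N" unfolding N_def using E(1) by (rule subset_normaliser)
  have NE: "g \<otimes> e \<otimes> inv g \<in> E" if "g \<in> N" "e \<in> E" for g e
    using that unfolding N_def normaliser_def by blast
  have cN': "c \<notin> N" using cN unfolding N_def .
  have "E \<noteq> carrier G" using cN' c(1) EN by blast
  then have "E \<subset> N" unfolding N_def by (rule normaliser_grows[OF ord p E(1)])
  then have 1: "p * p ^ 3 \<le> card N" using card_psubset_subgroup[OF ord p E(1) N] E(2) by simp
  have "N \<subset> carrier G" using cN' c(1) N.subset by blast
  then have "p * card N \<le> p ^ 5"
    using card_psubset_subgroup[OF ord p N subgroup_self] ord by (simp add: order_def)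
  then have "p * card N \<le> p * p ^ 4" by (simp add: eval_nat_numeral)
  then have "card N \<le> p ^ 4" using p1 by simp
  then have cardN: "card N = p ^ 4" using 1 by (simp add: eval_nat_numeral)
  have "N \<subset> normaliser G N" using \<open>N \<subset> carrier G\<close> by (intro normaliser_grows[OF ord p N]) blast
  then have "p * card N \<le> card (normaliser G N)"
    by (rule card_psubset_subgroup[OF ord p N subgroup_normaliser[OF fin N]])
  then have "order G \<le> card (normaliser G N)" using cardN ord by (simp add: eval_nat_numeral)
  then have NN: "normaliser G N = carrier G"
    using fin by (intro card_seteq) (auto simp: normaliser_def order_def)
  then have conjN: "g \<otimes> h \<otimes> inv g \<in> N" if "g \<in> carrier G" "h \<in> N" for g h
    using that by (auto simp: normaliser_def)
  then have normal: "N \<lhd> G" using N by (simp add: normal_inv_iff)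
  have "card (rcosets N) * p ^ 4 = p * p ^ 4" using lagrange[OF N] cardN ord by (simp add: eval_nat_numeral)
  then have "card (rcosets N) = p" using p1 by simp
  then have cpN: "c [^] p \<in> N" using pow_index_mem[OF normal c(1)] by simp
  define F where "F = (\<lambda>e. c \<otimes> e \<otimes> inv c) ` E"
  have F: "subgroup F G"
    unfolding F_def using conj_group_hom[OF c(1)] E(1) by (rule group_hom.subgroup_img_is_subgroup)
  have FN: "F \<subseteq> N" using conjN c(1) EN by (auto simp: F_def)
  have FG: "f \<in> carrier G" if "f \<in> F" for f using that F by (rule subgroup.mem_carrier[rotated])
  have FE: "\<not> F \<subseteq> E" using cN c(1) by (auto simp: F_def normaliser_def)
  have Fcomm: "u \<otimes> v = v \<otimes> u" if uv: "u \<in> F" "v \<in> F" for u v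
  proof -
    obtain a b where ab: "a \<in> E" "b \<in> E" "u = c \<otimes> a \<otimes> inv c" "v = c \<otimes> b \<otimes> inv c"
      using uv by (auto simp: F_def)
    then show ?thesis using conj_mult[OF c(1) EG EG, symmetric] E(3)[OF ab(1,2)] by simp
  qed
  have Fexp: "u [^] p = \<one>" if uF: "u \<in> F" for u
  proof -
    obtain a where a: "a \<in> E" "u = c \<otimes> a \<otimes> inv c" using uF by (auto simp: F_def)
    then show ?thesis
      using group_hom.hom_nat_pow[OF conj_group_hom[OF c(1)] EG, of a p] E(4) c(1) by simp
  qed
  have NF: "g \<otimes> f \<otimes> inv g \<in> F" if g: "g \<in> N" and f: "f \<in> F" for g f
  proof -
    obtain e where e: "e \<in> E" "f = c \<otimes> e \<otimes> inv c" using f by (auto simp: F_def)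
    define g' where "g' = inv c \<otimes> g \<otimes> inv (inv c)"
    have g': "g' \<in> N" unfolding g'_def using c(1) g by (intro conjN) auto
    have gG: "g \<in> carrier G" "g' \<in> carrier G" using g g' by auto
    have gc: "c \<otimes> g' = g \<otimes> c"
      using c(1) gG(1) by (simp add: g'_def m_assoc[symmetric])
    have "g \<otimes> f \<otimes> inv g = (g \<otimes> c) \<otimes> e \<otimes> inv (g \<otimes> c)"
      using conj_conj[of g c e] e gG c(1) EG by simp
    also have "\<dots> = c \<otimes> (g' \<otimes> e \<otimes> inv g') \<otimes> inv c"
      using conj_conj[of c g' e] e gG c(1) EG by (simp add: gc[symmetric])
    finally show ?thesis using NE[OF g' e(1)] by (simp add: F_def)
  qed
  define P where "P = (\<lambda>(e, f). e \<otimes> f) ` (E \<times> F)"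
  have PN: "P \<subseteq> N" using EN FN by (auto simp: P_def)
  have P: "subgroup P G"
  proof (rule finite_subgroupI[OF fin])
    show "P \<subseteq> carrier G" using PN N.subset by blast
    show "\<one> \<otimes> \<one> \<in> P"
      unfolding P_def using E(1) F by (intro image_eqI[of _ _ "(\<one>, \<one>)"]) (simp_all add: subgroup.one_closed)
    fix u v assume "u \<in> P" "v \<in> P"
    then obtain e f e' f' where ef: "e \<in> E" "f \<in> F" "e' \<in> E" "f' \<in> F" "u = e \<otimes> f" "v = e' \<otimes> f'"
      by (auto simp: P_def)
    have "f \<otimes> e' = f \<otimes> e' \<otimes> inv f \<otimes> f" using ef EG FG by (simp add: m_assoc)
    then have "u \<otimes> v = e \<otimes> (f \<otimes> e' \<otimes> inv f \<otimes> f) \<otimes> f'"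
      using ef EG FG by (simp add: m_assoc)
    also have "\<dots> = (e \<otimes> (f \<otimes> e' \<otimes> inv f)) \<otimes> (f \<otimes> f')"
      using ef EG FG by (simp add: m_assoc mult_cancel_inv)
    finally have uv: "u \<otimes> v = (e \<otimes> (f \<otimes> e' \<otimes> inv f)) \<otimes> (f \<otimes> f')" .
    have "f \<otimes> e' \<otimes> inv f \<in> E" using ef FN by (intro NE) auto
    then have "(e \<otimes> (f \<otimes> e' \<otimes> inv f), f \<otimes> f') \<in> E \<times> F"
      using ef E(1) F by (simp add: subgroup.m_closed)
    then show "u \<otimes> v \<in> P" unfolding uv P_def by (rule rev_image_eqI) simp
  qed
  have "E \<subset> P"
  proof -
    have "e \<in> P" if "e \<in> E" for e
      unfolding P_def by (rule image_eqI[of _ _ "(e, \<one>)"]) (use that EG F subgroup.one_closed in auto)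
    moreover have "f \<in> P" if "f \<in> F" for f
      unfolding P_def by (rule image_eqI[of _ _ "(\<one>, f)"]) (use that FG E(1) subgroup.one_closed in auto)
    ultimately show ?thesis using FE by blast
  qed
  then have "p * p ^ 3 \<le> card P" using card_psubset_subgroup[OF ord p E(1) P] E(2) by simp
  then have "card N \<le> card P" using cardN by (simp add: eval_nat_numeral)
  then have "P = N" using PN finite_subset[OF N.subset fin] by (intro card_seteq) auto
  then obtain e f where ef: "e \<in> E" "f \<in> F" "c [^] p = e \<otimes> f" using cpN by (auto simp: P_def)
  have G: "e \<in> carrier G" "f \<in> carrier G" using ef EG FG by auto
  \<comment> \<open>This is \<open>[f\<^sup>-\<^sup>1, e\<^sup>-\<^sup>1]\<close>, which lies in both \<open>E\<close> and \<open>F\<close> and so commutes with both factors.\<close>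
  define d where "d = inv f \<otimes> inv e \<otimes> f \<otimes> e"
  have "d = (inv f \<otimes> inv e \<otimes> inv (inv f)) \<otimes> e" using G by (simp add: d_def)
  moreover have "inv f \<otimes> inv e \<otimes> inv (inv f) \<in> E"
    using ef E(1) F FN by (intro NE) (auto simp: subgroup.m_inv_closed)
  ultimately have dE: "d \<in> E" using ef E(1) by (simp add: subgroup.m_closed)
  have "d = inv f \<otimes> (inv e \<otimes> f \<otimes> inv (inv e))" using G by (simp add: d_def m_assoc)
  moreover have "inv e \<otimes> f \<otimes> inv (inv e) \<in> F"
    using ef E(1) EN by (intro NF) (auto simp: subgroup.m_inv_closed)
  ultimately have dF: "d \<in> F" using ef F by (simp add: subgroup.m_closed subgroup.m_inv_closed)
  have dG: "d \<in> carrier G" using dE EG by simp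
  have fe: "f \<otimes> e = e \<otimes> f \<otimes> d" using G by (simp add: d_def m_assoc mult_cancel_inv)
  obtain m where m: "p choose 2 = p * m" using odd_dvd_choose_two[OF odd] by blast
  have "(c [^] p) [^] p = e [^] p \<otimes> f [^] p \<otimes> d [^] (p choose 2)"
    unfolding ef(3) using class_two_power[OF G dG fe E(3)[OF dE ef(1)] Fcomm[OF dF ef(2)]] .
  moreover have "d [^] (p choose 2) = \<one>"
    using nat_pow_pow[OF dG, of p m] E(4)[OF dE] m by simp
  ultimately have "(c [^] p) [^] p = \<one>" using E(4)[OF ef(1)] Fexp[OF ef(2)] by simp
  then show False using c nat_pow_pow[of c p p] by (simp add: power2_eq_square)
qed

text \<open>
  The products \<open>e c\<^sup>i\<close> with \<open>e \<in> E\<close> and \<open>i < p\<^sup>2\<close> are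
  distinct, so they exhaust a group of order at most \<open>p\<^sup>5\<close>. If \<open>x = e
  c\<^sup>i\<close> has \<open>x\<^sup>p = 1\<close>, then \<open>p\<close> divides \<open>i\<close> because
  \<open>E\<close> is normal with cyclic quotient of order \<open>p\<^sup>2\<close>. As
  \<open>c\<^sup>p\<close> commutes with \<open>e\<close>, it follows that \<open>c\<^sup>i\<close> itself has
  order dividing \<open>p\<close>, which forces \<open>i = 0\<close>.
\<close>
lemma exponent_p_elements_in_elementary_abelian:
  assumes ord: "order G = p ^ n" "n \<le> 5" and p: "Factorial_Ring.prime p" and odd: "odd p"
    and E: "subgroup E G" "card E = p ^ 3" "\<And>x y. x \<in> E \<Longrightarrow> y \<in> E \<Longrightarrow> x \<otimes> y = y \<otimes> x"
      "\<And>x. x \<in> E \<Longrightarrow> x [^] p = \<one>"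
    and c: "c \<in> carrier G" "ord c = p ^ 3"
    and x: "x \<in> carrier G" "x [^] p = \<one>"
  shows "x \<in> E"
proof -
  have p1: "p > 1" using p by (rule prime_gt_1_nat)
  have fin: "finite (carrier G)" using ord p1 order_gt_0_iff_finite by simp
  interpret E: subgroup E G by fact
  have c_dvd: "p ^ 2 dvd m" if m: "c [^] m \<in> E" for m
  proof -
    have "c [^] (m * p) = \<one>" using E(4)[OF m] nat_pow_pow c(1) by simp
    then have "p ^ 3 dvd m * p" using pow_eq_id[OF c(1)] c(2) by simp
    then have "p ^ 2 * p dvd m * p" by (simp add: eval_nat_numeral)
    then show ?thesis using p1 by simp
  qed
  define f where "f = (\<lambda>(e, i). e \<otimes> c [^] (i::nat))"
  have inj1: "i = j" if eq: "e \<otimes> c [^] i = e' \<otimes> c [^] j"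
    and e: "e \<in> E" "e' \<in> E" and ij: "i \<le> j" "j < p ^ 2" for e e' i j
  proof -
    have "e \<otimes> c [^] i = e' \<otimes> c [^] (j - i) \<otimes> c [^] i"
      using eq ij c(1) e nat_pow_mult[of c "j - i" i] by (simp add: m_assoc)
    then have "e = e' \<otimes> c [^] (j - i)" using c(1) e by simp
    then have "c [^] (j - i) = inv e' \<otimes> e" using c(1) e by (simp add: mult_cancel_inv)
    then have "p ^ 2 dvd j - i" using c_dvd e by simp
    then show ?thesis using ij dvd_imp_le[of "p ^ 2" "j - i"] by (cases "i = j") auto
  qed
  have inj: "inj_on f (E \<times> {..<p ^ 2})"
  proof (rule inj_onI, clarify)
    fix e i e' j
    assume e: "e \<in> E" "e' \<in> E" and ij: "i < p ^ 2" "j < p ^ 2" and "f (e, i) = f (e', j)"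
    then have eq: "e \<otimes> c [^] i = e' \<otimes> c [^] j" by (simp add: f_def)
    have "i = j"
      using inj1[OF eq e _ ij(2)] inj1[OF eq[symmetric] e(2,1) _ ij(1)] by (cases "i \<le> j") auto
    then show "e = e' \<and> i = j" using eq e c(1) by simp
  qed
  have fG: "f ` (E \<times> {..<p ^ 2}) \<subseteq> carrier G" using c(1) by (auto simp: f_def)
  have card_f: "card (f ` (E \<times> {..<p ^ 2})) = p ^ 5"
    using card_image[OF inj] E(2) by (simp add: card_cartesian_product power_add[symmetric])
  then have "p ^ 5 \<le> p ^ n" using card_mono[OF fin fG] ord by (simp add: order_def)
  then have "5 \<le> n" using p1 by simp
  then have ord5: "order G = p ^ 5" using ord by simp
  then have f_onto: "f ` (E \<times> {..<p ^ 2}) = carrier G"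
    using fG fin card_f by (intro card_seteq) (simp_all add: order_def)
  have decomp: "\<exists>e\<in>E. \<exists>i<p ^ 2. g = e \<otimes> c [^] i" if "g \<in> carrier G" for g
    using that unfolding f_onto[symmetric] by (auto simp: f_def)
  have "\<not> p ^ 3 dvd p ^ 2" using p1 by (simp add: power_dvd_imp_le nat_dvd_not_less)
  then have "c [^] (p ^ 2) \<noteq> \<one>" using pow_eq_id[OF c(1)] c(2) by simp
  then have cN: "c \<in> normaliser G E" using normalises_elementary_abelian[OF ord5 p odd E c(1)] by blast
  have N: "subgroup (normaliser G E) G" using fin E(1) by (rule subgroup_normaliser)
  have "g \<in> normaliser G E" if "g \<in> carrier G" for g
  proof -
    obtain e i where "e \<in> E" "g = e \<otimes> c [^] (i::nat)" using decomp \<open>g \<in> carrier G\<close> by blast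
    moreover have "c [^] i \<in> normaliser G E" for i :: nat
      by (induction i) (use N cN in \<open>auto simp: subgroup.one_closed subgroup.m_closed\<close>)
    ultimately show ?thesis
      using subset_normaliser[OF E(1)] N by (auto intro: subgroup.m_closed)
  qed
  then have normal: "E \<lhd> G" using E(1) by (auto simp: normal_inv_iff normaliser_def)
  obtain e i where x_eq: "e \<in> E" "i < p ^ 2" "x = e \<otimes> c [^] i" using decomp x(1) by blast
  have eG: "e \<in> carrier G" using x_eq(1) by simp
  have "E #> x = E #> c [^] i"
    unfolding x_eq(3) using coset_mult_assoc[OF E.subset eG, of "c [^] i"] E.rcos_const[OF is_group x_eq(1)] c(1) by simp
  moreover have "E #> (x [^] p) = (E #> x) [^]\<^bsub>G Mod E\<^esub> p"
    using normal.FactGroup_pow[OF normal x(1)] by simp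
  ultimately have "E #> \<one> = E #> (c [^] i) [^] p"
    using normal.FactGroup_pow[OF normal, of "c [^] i" p] x(2) c(1) by simp
  then have "(c [^] i) [^] p \<in> E"
    using rcos_self[OF _ E(1), of "(c [^] i) [^] p"] c(1) E.subset by simp
  then have "p ^ 2 dvd i * p" using c_dvd nat_pow_pow[OF c(1)] by simp
  then have "p dvd i" using p1 by (simp add: power2_eq_square)
  then obtain k where k: "i = p * k" by blast
  define d where "d = c [^] p"
  have dG: "d \<in> carrier G" using c(1) by (simp add: d_def)
  have ci: "c [^] i = d [^] k" using nat_pow_pow[OF c(1)] by (simp add: d_def k)
  have "d \<otimes> e = e \<otimes> d"
    unfolding d_def by (rule prime_power_centralises[OF ord5 p odd E cN x_eq(1)])
  then have "e \<otimes> d [^] k = d [^] k \<otimes> e" using group_commutes_pow dG eG by simp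
  then have "x [^] p = e [^] p \<otimes> (d [^] k) [^] p"
    unfolding x_eq(3) ci using dG eG by (intro pow_mult_distrib) auto
  then have "d [^] (k * p) = \<one>" using x(2) E(4)[OF x_eq(1)] dG nat_pow_pow by simp
  then have "p ^ 3 dvd p * (k * p)" using pow_eq_id[OF c(1)] c(1,2) nat_pow_pow by (simp add: d_def)
  then have "p dvd k" using p1 by (simp add: eval_nat_numeral mult.commute)
  then have "p ^ 2 dvd i" using k by (simp add: power2_eq_square)
  then have "i = 0" using x_eq(2) by (meson dvd_imp_le linorder_not_less not_gr_zero)
  then show ?thesis using x_eq eG by simp
qed

end

section \<open>Non-cyclic groups of order \<open>p\<^sup>3\<close>\<close>

context group
begin

lemma mem_generate_iff:
  assumes "a \<in> carrier G"
  shows "x \<in> generate G {a} \<longleftrightarrow> (\<exists>k::int. x = a [^] k)"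
  using generate_pow[OF assms] by auto

lemma ord_eq_prime_squared:
  assumes p: "Factorial_Ring.prime p" and g: "g \<in> carrier G" "g [^] (p ^ 2) = \<one>" "g [^] p \<noteq> \<one>"
  shows "ord g = p ^ 2"
proof -
  have "ord g dvd p ^ 2" using g pow_eq_id by simp
  then obtain k where k: "k \<le> 2" "ord g = p ^ k" using p by (auto simp: divides_primepow_nat)
  have "\<not> p ^ k dvd p ^ 1" using g k pow_eq_id[OF g(1), of p] by simp
  then have "\<not> k \<le> 1" using le_imp_power_dvd by blast
  then have "k = 2" using k(1) by simp
  then show ?thesis using k by simp
qed

lemma pow_mem_generate_prime_pow:
  fixes m :: int
  assumes p: "Factorial_Ring.prime p" and g: "g \<in> carrier G" "ord g = p ^ 2"
    and m: "(g [^] m) [^] p = \<one>"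
  shows "g [^] m \<in> generate G {g [^] p}"
proof -
  have p1: "p > 1" using p by (rule prime_gt_1_nat)
  have "g [^] (m * int p) = \<one>"
    using m g(1) by (simp add: int_pow_pow[symmetric] int_pow_int)
  then have "int p * int p dvd m * int p" using int_pow_eq_id[OF g(1)] g(2) by (simp add: power2_eq_square)
  then have "int p dvd m" using p1 by simp
  then obtain l where "m = int p * l" by blast
  then have "g [^] m = (g [^] p) [^] l" using g(1) by (simp add: int_pow_pow[symmetric] int_pow_int)
  then show ?thesis using g(1) by (auto simp: mem_generate_iff)
qed

lemma central_generate_normal:
  assumes z: "z \<in> centraliser G (carrier G)"
  shows "generate G {z} \<lhd> G" "\<And>a g. a \<in> generate G {z} \<Longrightarrow> g \<in> carrier G \<Longrightarrow> a \<otimes> g = g \<otimes> a"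
proof -
  have zG: "z \<in> carrier G" using z by (simp add: centraliser_def)
  have A: "subgroup (generate G {z}) G" using zG by (intro generate_is_subgroup) simp
  show comm: "a \<otimes> g = g \<otimes> a" if a: "a \<in> generate G {z}" and g: "g \<in> carrier G" for a g
  proof -
    obtain k :: int where k: "a = z [^] k" using a zG by (auto simp: mem_generate_iff)
    have "z \<otimes> g = g \<otimes> z \<otimes> \<one>" using z g by (simp add: centraliser_def)
    then have "z [^] k \<otimes> g [^] (1::int) = g [^] (1::int) \<otimes> z [^] k \<otimes> \<one> [^] (1 * k)"
      using zG g by (intro commutator_int_pow) auto
    then show ?thesis using g zG k by simp
  qed
  have "g \<otimes> a \<otimes> inv g \<in> generate G {z}" if a: "a \<in> generate G {z}" and g: "g \<in> carrier G" for a g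
  proof -
    have "a \<in> carrier G" using subgroup.mem_carrier[OF A a] .
    then have "g \<otimes> a \<otimes> inv g = a" using comm[OF a g] g by (subst conj_eq_iff) auto
    then show ?thesis using a by simp
  qed
  then show "generate G {z} \<lhd> G" using A by (simp add: normal_inv_iff)
qed

text \<open>
  If some central \<open>g\<close> has order \<open>p\<^sup>2\<close>, take \<open>z = g\<^sup>p\<close>: the
  quotient by \<open>g\<close> has order \<open>p\<close>, so \<open>p\<close>-th powers are powers of
  \<open>g\<close>, and of order at most \<open>p\<close>. If not, any central \<open>z\<close> of order
  \<open>p\<close> will do: an element \<open>g\<close> of order \<open>p\<^sup>2\<close> is not central, its
  centraliser is therefore the group of its own powers, and \<open>z\<close> is one of them, so that
  \<open>z\<close> and \<open>g\<^sup>p\<close> generate the same subgroup.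
\<close>
lemma central_with_pth_powers:
  assumes ord: "order G = p ^ 3" and p: "Factorial_Ring.prime p"
    and exp: "\<And>g. g \<in> carrier G \<Longrightarrow> g [^] (p ^ 2) = \<one>"
  obtains z where "z \<in> centraliser G (carrier G)" "ord z = p"
    "\<And>g. g \<in> carrier G \<Longrightarrow> g [^] p \<in> generate G {z}"
proof -
  have p1: "p > 1" using p by (rule prime_gt_1_nat)
  have fin: "finite (carrier G)" using ord p1 order_gt_0_iff_finite by simp
  have expp: "(g [^] p) [^] p = \<one>" if "g \<in> carrier G" for g
    using exp[OF that] nat_pow_pow[OF that, of p p] by (simp add: power2_eq_square)
  have sub: "subgroup (generate G {g}) G" if "g \<in> carrier G" for g
    using that by (intro generate_is_subgroup) simp
  show ?thesis
  proof (cases "\<exists>g\<in>centraliser G (carrier G). g [^] p \<noteq> \<one>")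
    case True
    then obtain g where g: "g \<in> centraliser G (carrier G)" "g [^] p \<noteq> \<one>" by blast
    have gG: "g \<in> carrier G" using g by (simp add: centraliser_def)
    have ordg: "ord g = p ^ 2" using ord_eq_prime_squared[OF p gG exp[OF gG] g(2)] .
    have "ord (g [^] p) = p" using ord_pow[OF gG, of p] ordg p1 by (simp add: power2_eq_square)
    moreover have "g [^] p \<in> centraliser G (carrier G)"
      using g(1) gG by (auto simp: centraliser_def group_commutes_pow)
    moreover have "h [^] p \<in> generate G {g [^] p}" if h: "h \<in> carrier G" for h
    proof -
      have "card (rcosets (generate G {g})) * p ^ 2 = p ^ 3"
        using lagrange[OF sub[OF gG]] generate_pow_card[OF gG] ordg ord by simp
      then have "card (rcosets (generate G {g})) * p ^ 2 = p * p ^ 2" by (simp add: eval_nat_numeral)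
      then have "card (rcosets (generate G {g})) = p" using p1 by simp
      then have "h [^] p \<in> generate G {g}"
        using pow_index_mem[OF central_generate_normal(1)[OF g(1)] h] by simp
      then obtain m :: int where m: "h [^] p = g [^] m" using gG by (auto simp: mem_generate_iff)
      show ?thesis
        unfolding m by (rule pow_mem_generate_prime_pow[OF p gG ordg]) (use expp[OF h] m in simp)
    qed
    ultimately show ?thesis using that by blast
  next
    case False
    obtain z where z: "z \<in> centraliser G (carrier G)" "ord z = p"
      using central_element_of_prime_order[OF ord p] by auto
    have zG: "z \<in> carrier G" using z by (simp add: centraliser_def)
    have "g [^] p \<in> generate G {z}" if g: "g \<in> carrier G" for g
    proof (cases "g [^] p = \<one>")
      case True
      then show ?thesis using subgroup.one_closed[OF sub[OF zG]] by simp
    next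
      case gp: False
      have ordg: "ord g = p ^ 2" using ord_eq_prime_squared[OF p g exp[OF g] gp] .
      let ?C = "centraliser G {g}"
      have C: "subgroup ?C G" using fin g by (intro subgroup_centraliser) auto
      have "g \<notin> centraliser G (carrier G)" using False gp by blast
      then obtain a where "a \<in> carrier G" "g \<otimes> a \<noteq> a \<otimes> g" using g by (auto simp: centraliser_def)
      then have "a \<in> carrier G - ?C" by (auto simp: centraliser_def)
      then have "?C \<noteq> carrier G" by blast
      then have "?C \<subset> carrier G" using subgroup.subset[OF C] by blast
      then have "p * card ?C \<le> p ^ 3"
        using card_psubset_subgroup[OF ord p C subgroup_self] ord by (simp add: order_def)
      then have "p * card ?C \<le> p * p ^ 2" by (simp add: eval_nat_numeral)
      then have "card ?C \<le> card (generate G {g})" using p1 generate_pow_card[OF g] ordg by simp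
      moreover have "generate G {g} \<subseteq> ?C"
        using g C by (intro generate_subgroup_incl) (auto simp: centraliser_def)
      ultimately have "generate G {g} = ?C"
        using finite_subset[OF subgroup.subset[OF C] fin] by (intro card_seteq) auto
      moreover have "z \<in> ?C" using z g by (auto simp: centraliser_def)
      ultimately have "z \<in> generate G {g}" by simp
      then obtain m :: int where m: "z = g [^] m" using g by (auto simp: mem_generate_iff)
      have "z [^] p = \<one>" using pow_ord_eq_1[OF zG] z(2) by simp
      then have "z \<in> generate G {g [^] p}"
        unfolding m by (rule pow_mem_generate_prime_pow[OF p g ordg])
      then have sub_zg: "generate G {z} \<subseteq> generate G {g [^] p}"
        using g by (intro generate_subgroup_incl sub) auto
      have "ord (g [^] p) = p" using ord_pow[OF g, of p] ordg p1 by (simp add: power2_eq_square)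
      then have "card (generate G {g [^] p}) = card (generate G {z})"
        using generate_pow_card[OF zG] generate_pow_card[of "g [^] p"] g z(2) by simp
      then have "generate G {z} = generate G {g [^] p}"
        using sub_zg finite_subset[OF subgroup.subset[OF sub] fin] g by (intro card_seteq) auto
      then show ?thesis using generate.incl[of "g [^] p" "{g [^] p}"] by simp
    qed
    then show ?thesis using z that by blast
  qed
qed

text \<open>
  The quotient by \<open>z\<close> has order \<open>p\<^sup>2\<close>, hence is commutative.
\<close>
lemma commutator_in_central_generate:
  assumes ord: "order G = p ^ 3" and p: "Factorial_Ring.prime p"
    and z: "z \<in> centraliser G (carrier G)" "ord z = p"
    and gh: "g \<in> carrier G" "h \<in> carrier G"
  obtains k :: int where "h \<otimes> g = g \<otimes> h \<otimes> z [^] k"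
proof -
  have p1: "p > 1" using p by (rule prime_gt_1_nat)
  have zG: "z \<in> carrier G" using z by (simp add: centraliser_def)
  define A where "A = generate G {z}"
  interpret A: normal A G unfolding A_def using z(1) by (rule central_generate_normal)
  interpret Q: group "G Mod A" by (rule A.factorgroup_is_group)
  have "card A = p" using generate_pow_card[OF zG] z(2) by (simp add: A_def)
  then have "card (rcosets A) * p = p ^ 2 * p"
    using lagrange[OF A.subgroup_axioms] ord power_add[of p 2 1] by (simp del: power_add)
  then have "order (G Mod A) = p ^ 2" using p1 by (simp add: order_def FactGroup_def)
  then have "(A #> h) <#> (A #> g) = (A #> g) <#> (A #> h)"
    using Q.order_prime_squared_comm[OF _ p, of "A #> h" "A #> g"] gh
    by (simp add: carrier_FactGroup)
  then have "A #> (h \<otimes> g) = A #> (g \<otimes> h)" using gh by (simp add: A.rcos_sum)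
  then have "h \<otimes> g \<in> A #> (g \<otimes> h)" using rcos_self[of "h \<otimes> g" A] gh A.subgroup_axioms by simp
  then obtain a where a: "a \<in> A" "h \<otimes> g = a \<otimes> (g \<otimes> h)" by (auto simp: r_coset_def)
  then have "h \<otimes> g = g \<otimes> h \<otimes> a"
    using central_generate_normal(2)[OF z(1), of a "g \<otimes> h"] gh by (simp add: A_def)
  moreover obtain k :: int where "a = z [^] k" using a zG by (auto simp: A_def mem_generate_iff)
  ultimately show ?thesis using that by blast
qed

lemma prime_dvd_exponent:
  fixes m :: int
  assumes p: "Factorial_Ring.prime p" and H: "subgroup H G" and y: "y \<in> carrier G" "y \<notin> H"
    and yp: "y [^] p \<in> H" and ym: "y [^] m \<in> H"
  shows "int p dvd m"
proof (rule ccontr)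
  assume "\<not> int p dvd m"
  then have "coprime (int p) m" using p by (simp add: prime_imp_coprime)
  then obtain a b where ab: "a * int p + b * m = 1"
    by (metis bezout_int coprime_iff_gcd_eq_1)
  have pow: "u [^] k \<in> H" if "u \<in> H" for u and k :: int
    using that H by (simp add: subgroup_int_pow_closed)
  have "y = y [^] (int p * a + m * b)" using ab y(1) by (simp add: mult.commute)
  also have "\<dots> = (y [^] p) [^] a \<otimes> (y [^] m) [^] b"
    using y(1) by (simp add: int_pow_mult int_pow_pow[symmetric] int_pow_int)
  finally have "y \<in> H" using pow[OF yp] pow[OF ym] H subgroup.m_closed by metis
  then show False using y by simp
qed

end

section \<open>A group of order \<open>p\<^sup>6\<close> containing all groups of order \<open>p\<^sup>3\<close>\<close>

text \<open>
  The product of the group \<open>U\<close> lifted to integer tuples. Computations are carried out with such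
  unreduced representatives and reduced only at the end.
\<close>
definition raw_mult :: "nat \<Rightarrow> int \<times> int \<times> int \<times> int \<Rightarrow> int \<times> int \<times> int \<times> int \<Rightarrow> int \<times> int \<times> int \<times> int"
  where "raw_mult p = (\<lambda>(a, x, y, w) (a', x', y', w').
    (a + a' + int p ^ 2 * (y * x'), x + x', y + y', w + w'))"

definition reduce :: "nat \<Rightarrow> int \<times> int \<times> int \<times> int \<Rightarrow> int \<times> int \<times> int \<times> int"
  where "reduce p = (\<lambda>(a, x, y, w). (a mod int p ^ 3, x mod int p, y mod int p, w mod int p))"

definition universal_group :: "nat \<Rightarrow> (int \<times> int \<times> int \<times> int) monoid"
  where "universal_group p = \<lparr>carrier = {0..<int p ^ 3} \<times> {0..<int p} \<times> {0..<int p} \<times> {0..<int p},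
    monoid.mult = (\<lambda>g h. reduce p (raw_mult p g h)), one = (0, 0, 0, 0)\<rparr>"

lemma reduce_eq_iff:
  "reduce p (a, x, y, w) = reduce p (a', x', y', w') \<longleftrightarrow>
    int p ^ 3 dvd a - a' \<and> int p dvd x - x' \<and> int p dvd y - y' \<and> int p dvd w - w'"
  by (simp add: reduce_def mod_eq_dvd_iff)

lemma reduce_raw_mult:
  "reduce p (raw_mult p (reduce p g) h) = reduce p (raw_mult p g h)"
  "reduce p (raw_mult p g (reduce p h)) = reduce p (raw_mult p g h)"
proof -
  obtain a x y w a' x' y' w' where gh: "g = (a, x, y, w)" "h = (a', x', y', w')"
    by (metis surj_pair)
  have mod: "m dvd (u mod m - u)" for m u :: int by (simp add: mod_eq_dvd_iff[symmetric])
  have p3: "int p ^ 3 dvd int p ^ 2 * u" if "int p dvd u" for u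
    using mult_dvd_mono[OF dvd_refl[of "int p ^ 2"] that] by (simp add: eval_nat_numeral mult.assoc)
  have "(a mod int p ^ 3 + a' + int p ^ 2 * (y mod int p * x')) - (a + a' + int p ^ 2 * (y * x'))
      = (a mod int p ^ 3 - a) + int p ^ 2 * ((y mod int p - y) * x')" by (simp add: algebra_simps)
  moreover have "int p ^ 3 dvd \<dots>" by (intro dvd_add mod p3 dvd_mult2)
  ultimately have D: "int p ^ 3 dvd
      (a mod int p ^ 3 + a' + int p ^ 2 * (y mod int p * x')) - (a + a' + int p ^ 2 * (y * x'))"
    by (simp only:)
  have "reduce p (a mod int p ^ 3 + a' + int p ^ 2 * (y mod int p * x'),
      x mod int p + x', y mod int p + y', w mod int p + w') =
    reduce p (a + a' + int p ^ 2 * (y * x'), x + x', y + y', w + w')"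
    unfolding reduce_eq_iff by (intro conjI D) (simp_all add: mod)
  then show "reduce p (raw_mult p (reduce p g) h) = reduce p (raw_mult p g h)"
    unfolding gh raw_mult_def by (simp only: reduce_def prod.case)
  have "(a + a' mod int p ^ 3 + int p ^ 2 * (y * (x' mod int p))) - (a + a' + int p ^ 2 * (y * x'))
      = (a' mod int p ^ 3 - a') + int p ^ 2 * (y * (x' mod int p - x'))" by (simp add: algebra_simps)
  moreover have "int p ^ 3 dvd \<dots>" by (intro dvd_add mod p3 dvd_mult)
  ultimately have D: "int p ^ 3 dvd
      (a + a' mod int p ^ 3 + int p ^ 2 * (y * (x' mod int p))) - (a + a' + int p ^ 2 * (y * x'))"
    by (simp only:)
  have "reduce p (a + a' mod int p ^ 3 + int p ^ 2 * (y * (x' mod int p)),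
      x + x' mod int p, y + y' mod int p, w + w' mod int p) =
    reduce p (a + a' + int p ^ 2 * (y * x'), x + x', y + y', w + w')"
    unfolding reduce_eq_iff by (intro conjI D) (simp_all add: mod)
  then show "reduce p (raw_mult p g (reduce p h)) = reduce p (raw_mult p g h)"
    unfolding gh raw_mult_def by (simp only: reduce_def prod.case)
qed

context
  fixes p :: nat
  assumes p0: "p > 0"
begin

lemma reduce_in_carrier: "reduce p g \<in> carrier (universal_group p)"
  using p0 by (auto simp: universal_group_def reduce_def split: prod.split)

lemma reduce_carrier: "g \<in> carrier (universal_group p) \<Longrightarrow> reduce p g = g"
  using p0 by (auto simp: universal_group_def reduce_def)

lemma mult_reduce:
  "reduce p g \<otimes>\<^bsub>universal_group p\<^esub> reduce p h = reduce p (raw_mult p g h)"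
  by (simp add: universal_group_def reduce_raw_mult)

lemma one_universal_group: "\<one>\<^bsub>universal_group p\<^esub> = reduce p (0, 0, 0, 0)"
  by (simp add: universal_group_def reduce_def)

lemma carrier_universal_groupE:
  assumes "g \<in> carrier (universal_group p)"
  obtains a x y w where "g = reduce p (a, x, y, w)"
  using that reduce_carrier[OF assms] by (metis surj_pair)

lemma group_universal_group: "group (universal_group p)" (is "group ?U")
proof (rule groupI)
  fix g h assume gh: "g \<in> carrier ?U" "h \<in> carrier ?U"
  show "g \<otimes>\<^bsub>?U\<^esub> h \<in> carrier ?U" using reduce_in_carrier by (simp add: universal_group_def)
  fix k assume k: "k \<in> carrier ?U"
  show "g \<otimes>\<^bsub>?U\<^esub> h \<otimes>\<^bsub>?U\<^esub> k = g \<otimes>\<^bsub>?U\<^esub> (h \<otimes>\<^bsub>?U\<^esub> k)"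
  proof -
    obtain a x y w a' x' y' w' b u v t where e: "g = reduce p (a, x, y, w)" "h = reduce p (a', x', y', w')"
      "k = reduce p (b, u, v, t)"
      using gh k by (elim carrier_universal_groupE)
    show ?thesis
      unfolding e mult_reduce by (simp add: raw_mult_def algebra_simps)
  qed
next
  show "\<one>\<^bsub>?U\<^esub> \<in> carrier ?U" unfolding one_universal_group by (rule reduce_in_carrier)
next
  fix g assume g: "g \<in> carrier ?U"
  then obtain a x y w where e: "g = reduce p (a, x, y, w)" by (elim carrier_universal_groupE)
  show "\<one>\<^bsub>?U\<^esub> \<otimes>\<^bsub>?U\<^esub> g = g" unfolding e one_universal_group mult_reduce by (simp add: raw_mult_def)
  show "\<exists>h\<in>carrier ?U. h \<otimes>\<^bsub>?U\<^esub> g = \<one>\<^bsub>?U\<^esub>"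
    by (intro bexI[of _ "reduce p (- a + int p ^ 2 * (y * x), - x, - y, - w)"] reduce_in_carrier)
      (unfold e one_universal_group mult_reduce, simp add: raw_mult_def)
qed

lemma order_universal_group: "order (universal_group p) = p ^ 6"
proof -
  have "nat (int p ^ 3) = p ^ 3" by (simp add: nat_power_eq)
  then show ?thesis by (simp add: order_def universal_group_def card_cartesian_product eval_nat_numeral)
qed

lemma nat_pow_universal_group:
  "reduce p (a, x, y, w) [^]\<^bsub>universal_group p\<^esub> (n::nat) =
    reduce p (int n * a + int p ^ 2 * (int (n choose 2) * (x * y)), int n * x, int n * y, int n * w)"
proof (induction n)
  case 0
  then show ?case using one_universal_group by (simp add: numeral_2_eq_2)
next
  case (Suc n)
  show ?case
    unfolding nat_pow_Suc Suc mult_reduce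
    by (simp add: raw_mult_def numeral_2_eq_2 algebra_simps)
qed

end

lemma embeddable_if_inj_hom:
  assumes "group K" "group G" and h: "h \<in> hom K G" "inj_on h (carrier K)"
  shows "embeddable K G"
proof -
  have "h \<in> iso K (G\<lparr>carrier := h ` carrier K\<rparr>)"
    using h by (auto simp: iso_def hom_def bij_betw_def)
  moreover have "group_hom K G h" using assms by (simp add: group_hom_def group_hom_axioms_def)
  then have "subgroup (h ` carrier K) G" by (rule group_hom.img_is_subgroup)
  ultimately show ?thesis unfolding embeddable_def by (blast intro: is_isoI)
qed

text \<open>
  Both groups are presented as images of one parameter type with a common operation \<open>f\<close>.
  Comparing when two parameters have equal images gives well-definedness and injectivity of the embedding at
  once.
\<close>
lemma embeddable_if_coordinates:
  fixes K :: "('k, 'c) monoid_scheme" and G :: "('g, 'd) monoid_scheme"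
    and \<psi> :: "'t \<Rightarrow> 'k" and \<Phi> :: "'t \<Rightarrow> 'g"
  assumes K: "group K" and G: "group G"
    and \<psi>: "carrier K = range \<psi>" "\<And>s t. \<psi> (f s t) = \<psi> s \<otimes>\<^bsub>K\<^esub> \<psi> t"
    and \<Phi>: "range \<Phi> \<subseteq> carrier G" "\<And>s t. \<Phi> (f s t) = \<Phi> s \<otimes>\<^bsub>G\<^esub> \<Phi> t"
    and eq: "\<And>s t. \<psi> s = \<psi> t \<longleftrightarrow> \<Phi> s = \<Phi> t"
  shows "embeddable K G"
proof -
  define h where "h = \<Phi> \<circ> inv_into UNIV \<psi>"
  have h\<psi>: "h (\<psi> t) = \<Phi> t" for t
    using eq f_inv_into_f[of "\<psi> t" \<psi> UNIV] by (simp add: h_def)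
  have hom: "h \<in> hom K G"
    using \<psi> \<Phi> by (auto simp: hom_def h\<psi> \<psi>(2)[symmetric])
  have "inj_on h (carrier K)" using \<psi>(1) eq by (auto simp: inj_on_def h\<psi>)
  with K G hom show ?thesis by (rule embeddable_if_inj_hom)
qed

lemma embeddableD:
  assumes "embeddable K G"
  obtains h where "h \<in> hom K G" "inj_on h (carrier K)"
proof -
  obtain S h where S: "subgroup S G" and h: "h \<in> iso K (G\<lparr>carrier := S\<rparr>)"
    using assms by (auto simp: embeddable_def is_iso_def)
  then have "h \<in> hom K G" "inj_on h (carrier K)"
    using subgroup.subset[OF S] by (auto simp: iso_def hom_def bij_betw_def)
  then show ?thesis by (rule that)
qed

lemma cyclic_embeddable:
  fixes K (structure)
  assumes "group K" and ord: "order K = p ^ 3" and p: "Factorial_Ring.prime p"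
    and g: "g \<in> carrier K" "g [^] (p ^ 2) \<noteq> \<one>"
  shows "embeddable K (universal_group p)"
proof -
  interpret group K by fact
  have p0: "p > 0" using p by (rule prime_gt_0_nat)
  have fin: "finite (carrier K)" using ord p0 order_gt_0_iff_finite by simp
  have "ord g dvd p ^ 3" using ord_dvd_group_order[OF g(1)] ord by simp
  then obtain k where k: "k \<le> 3" "ord g = p ^ k" using p by (auto simp: divides_primepow_nat)
  have "\<not> p ^ k dvd p ^ 2" using g k pow_eq_id[OF g(1), of "p ^ 2"] by simp
  then have "\<not> k \<le> 2" using le_imp_power_dvd by blast
  then have "k = 3" using k(1) by simp
  then have ordg: "ord g = p ^ 3" using k by simp
  have "generate K {g} = carrier K"
    using fin g(1) generate_pow_card[OF g(1)] ordg ord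
    by (intro card_seteq generate_incl) (simp_all add: order_def)
  then have "carrier K = {g [^] k | k. k \<in> (UNIV :: int set)}" using generate_pow[OF g(1)] by simp
  then have range: "carrier K = range (\<lambda>i::int. g [^] i)" by (simp only: full_SetCompr_eq UNIV_I simp_thms)
  show ?thesis
  proof (rule embeddable_if_coordinates[where f = "(+)", OF _ _ range])
    show "range (\<lambda>i. reduce p (i, 0, 0, 0)) \<subseteq> carrier (universal_group p)"
      using reduce_in_carrier[OF p0] by blast
    show "reduce p (i + j, 0, 0, 0) = reduce p (i, 0, 0, 0) \<otimes>\<^bsub>universal_group p\<^esub> reduce p (j, 0, 0, 0)" for i j
      unfolding mult_reduce[OF p0] by (simp add: raw_mult_def)
    show "g [^] i = g [^] j \<longleftrightarrow> reduce p (i, 0, 0, 0) = reduce p (j, 0, 0, 0)" for i j :: int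
      using int_pow_eq[OF g(1), of i j] ordg by (simp add: reduce_eq_iff dvd_diff_commute)
  qed (use \<open>group K\<close> group_universal_group[OF p0] g(1) in \<open>auto simp: int_pow_mult\<close>)
qed

text \<open>
  The parameters are the integer exponents of the words \<open>x\<^sup>i y\<^sup>j z\<^sup>k\<close>; no
  normal form is chosen, so no carries occur. Two words are equal iff \<open>p\<close> divides \<open>i -
  i'\<close> and \<open>j - j'\<close>, say with quotients \<open>m\<close> and \<open>n\<close>, and also
  \<open>\<alpha> m + \<beta> n + k - k'\<close>. The same conditions govern the tuples.
\<close>
lemma noncyclic_embeddable:
  fixes K (structure)
  assumes "group K" and ord: "order K = p ^ 3" and p: "Factorial_Ring.prime p"
    and exp: "\<And>g. g \<in> carrier K \<Longrightarrow> g [^] (p ^ 2) = \<one>"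
  shows "embeddable K (universal_group p)"
proof -
  interpret group K by fact
  have p1: "p > 1" and p0: "p > 0" using prime_gt_1_nat[OF p] by auto
  have fin: "finite (carrier K)" using ord p0 order_gt_0_iff_finite by simp
  obtain z where z: "z \<in> centraliser K (carrier K)" "ord z = p"
    and pth: "\<And>g. g \<in> carrier K \<Longrightarrow> g [^] p \<in> generate K {z}"
    using central_with_pth_powers[OF ord p exp] by blast
  have zK: "z \<in> carrier K" using z by (simp add: centraliser_def)
  define A where "A = generate K {z}"
  have A_iff: "a \<in> A \<longleftrightarrow> (\<exists>k::int. a = z [^] k)" for a unfolding A_def using zK by (rule mem_generate_iff)
  have A: "subgroup A K" unfolding A_def using zK by (intro generate_is_subgroup) simp
  have cardA: "card A = p" using generate_pow_card[OF zK] z(2) by (simp add: A_def)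
  have zc: "z [^] k \<otimes> g = g \<otimes> z [^] k" if "g \<in> carrier K" for g and k :: int
    using central_generate_normal(2)[OF z(1) _ that] A_iff unfolding A_def by blast
  have "A \<noteq> carrier K" using cardA ord p1 by (auto simp: order_def eval_nat_numeral)
  then obtain x where x: "x \<in> carrier K" "x \<notin> A" using subgroup.subset[OF A] by blast
  obtain \<alpha> :: int where \<alpha>: "x [^] p = z [^] \<alpha>" using pth[OF x(1)] A_iff unfolding A_def by blast
  have zx: "z [^] k \<otimes> x [^] i = x [^] i \<otimes> z [^] k"
    "h \<in> carrier K \<Longrightarrow> z [^] k \<otimes> (x [^] i \<otimes> h) = x [^] i \<otimes> (z [^] k \<otimes> h)" for h and i k :: int
    using zc[of "x [^] i" k] x(1) zK by (simp_all add: m_assoc[symmetric])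
  \<comment> \<open>The subgroup generated by \<open>x\<close> and \<open>z\<close>: it has at most \<open>p\<^sup>2\<close> elements, so there is some \<open>y\<close> outside.\<close>
  define B where "B = range (\<lambda>(i::int, k::int). x [^] i \<otimes> z [^] k)"
  have B_iff: "b \<in> B \<longleftrightarrow> (\<exists>(i::int) (k::int). b = x [^] i \<otimes> z [^] k)" for b by (auto simp: B_def)
  have xp: "x [^] (i + int p * m) = x [^] i \<otimes> z [^] (\<alpha> * m)" for i m
    using x(1) zK \<alpha> by (simp add: int_pow_mult int_pow_pow[symmetric] int_pow_int)
  have B: "subgroup B K"
  proof (rule finite_subgroupI[OF fin])
    show "B \<subseteq> carrier K" using x(1) zK by (auto simp: B_def)
    show "x [^] (0::int) \<otimes> z [^] (0::int) \<in> B" unfolding B_iff by blast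
    fix b b' assume "b \<in> B" "b' \<in> B"
    then obtain i k i' k' :: int where "b = x [^] i \<otimes> z [^] k" "b' = x [^] i' \<otimes> z [^] k'"
      by (auto simp: B_iff)
    then have "b \<otimes> b' = x [^] (i + i') \<otimes> z [^] (k + k')"
      using x(1) zK by (simp add: int_pow_mult m_assoc zx)
    then show "b \<otimes> b' \<in> B" unfolding B_iff by blast
  qed
  have AB: "A \<subseteq> B"
  proof
    fix a assume "a \<in> A"
    then obtain k :: int where "a = z [^] k" using A_iff by blast
    then have "a = x [^] (0::int) \<otimes> z [^] k" using zK by simp
    then show "a \<in> B" unfolding B_iff by blast
  qed
  have "card B \<le> p * p"
  proof -
    have "B \<subseteq> (\<lambda>(i, a). x [^] int i \<otimes> a) ` ({..<p} \<times> A)"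
    proof
      fix b assume "b \<in> B"
      then obtain i k :: int where b: "b = x [^] i \<otimes> z [^] k" by (auto simp: B_iff)
      have "i = i mod int p + int p * (i div int p)" by simp
      then have "b = x [^] (i mod int p) \<otimes> z [^] (\<alpha> * (i div int p)) \<otimes> z [^] k"
        using b xp[of "i mod int p" "i div int p"] by simp
      then have "b = x [^] int (nat (i mod int p)) \<otimes> z [^] (\<alpha> * (i div int p) + k)"
        using x(1) zK p0 by (simp add: m_assoc int_pow_mult)
      moreover have "nat (i mod int p) < p" using p0 by (simp add: nat_less_iff)
      ultimately show "b \<in> (\<lambda>(i, a). x [^] int i \<otimes> a) ` ({..<p} \<times> A)"
        using A_iff by (intro image_eqI[of _ _ "(nat (i mod int p), z [^] (\<alpha> * (i div int p) + k))"]) auto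
    qed
    then have "card B \<le> card ({..<p} \<times> A)"
      using finite_subset[OF subgroup.subset[OF A] fin] by (intro surj_card_le) auto
    then show ?thesis using cardA by (simp add: card_cartesian_product)
  qed
  also have "p * p < p ^ 3" using p1 by (simp add: eval_nat_numeral)
  finally have "B \<noteq> carrier K" using ord by (auto simp: order_def)
  then obtain y where y: "y \<in> carrier K" "y \<notin> B" using subgroup.subset[OF B] by blast
  obtain \<beta> :: int where \<beta>: "y [^] p = z [^] \<beta>" using pth[OF y(1)] A_iff unfolding A_def by blast
  have zy: "z [^] k \<otimes> y [^] i = y [^] i \<otimes> z [^] k"
    "h \<in> carrier K \<Longrightarrow> z [^] k \<otimes> (y [^] i \<otimes> h) = y [^] i \<otimes> (z [^] k \<otimes> h)" for h and i k :: int
    using zc[of "y [^] i" k] y(1) zK by (simp_all add: m_assoc[symmetric])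
  have yp: "y [^] (j + int p * n) = y [^] j \<otimes> z [^] (\<beta> * n)" for j n
    using y(1) zK \<beta> by (simp add: int_pow_mult int_pow_pow[symmetric] int_pow_int)
  obtain \<gamma> :: int where \<gamma>: "y \<otimes> x = x \<otimes> y \<otimes> z [^] \<gamma>"
    using commutator_in_central_generate[OF ord p z x(1) y(1)] by blast
  have yx: "y [^] j \<otimes> x [^] i = x [^] i \<otimes> y [^] j \<otimes> z [^] (\<gamma> * (i * j))" for i j :: int
    using commutator_int_pow[OF x(1) y(1) _ \<gamma> zc[OF x(1)] zc[OF y(1)], of j i] zK
    by (simp add: int_pow_pow)
  define \<psi> where "\<psi> = (\<lambda>(i::int, j::int, k::int). x [^] i \<otimes> y [^] j \<otimes> z [^] k)"
  \<comment> \<open>The tuples \<open>(p \<alpha>, 1, 0, 0)\<close>, \<open>(p \<beta>, 0, \<gamma>, 1)\<close> and \<open>(p\<^sup>2, 0, 0, 0)\<close> stand for \<open>x\<close>, \<open>y\<close> and \<open>z\<close>.\<close>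
  define \<Phi> where "\<Phi> = (\<lambda>(i, j, k).
    reduce p (int p * \<alpha> * i + int p * \<beta> * j + int p ^ 2 * k, i, \<gamma> * j, j))"
  define f where "f = (\<lambda>(i, j, k) (i', j', k'). (i + i', j + j', \<gamma> * (i' * j) + (k + k')))"
  have \<psi>_mult: "\<psi> (f s t) = \<psi> s \<otimes> \<psi> t" for s t
  proof -
    obtain i j k i' j' k' where st: "s = (i, j, k)" "t = (i', j', k')" by (metis surj_pair)
    have "\<psi> s \<otimes> \<psi> t = x [^] i \<otimes> (y [^] j \<otimes> x [^] i') \<otimes> y [^] j' \<otimes> (z [^] k \<otimes> z [^] k')"
      using x(1) y(1) zK by (simp add: \<psi>_def st m_assoc zx zy)
    also have "\<dots> = x [^] i \<otimes> x [^] i' \<otimes> (y [^] j \<otimes> y [^] j') \<otimes> (z [^] (\<gamma> * (i' * j)) \<otimes> (z [^] k \<otimes> z [^] k'))"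
      unfolding yx using x(1) y(1) zK by (simp add: m_assoc zx zy)
    finally show ?thesis using x(1) y(1) zK by (simp add: \<psi>_def f_def st int_pow_mult)
  qed
  have \<Phi>_mult: "\<Phi> (f s t) = \<Phi> s \<otimes>\<^bsub>universal_group p\<^esub> \<Phi> t" for s t
    by (cases s; cases t) (simp add: \<Phi>_def f_def mult_reduce[OF p0] raw_mult_def algebra_simps)
  have \<psi>_shift: "\<psi> (i + int p * m, j + int p * n, k) = \<psi> (i, j, k') \<longleftrightarrow> int p dvd \<beta> * n + (\<alpha> * m + k) - k'"
    for i j k k' m n
  proof -
    have "\<psi> (i + int p * m, j + int p * n, k) = x [^] i \<otimes> y [^] j \<otimes> z [^] (\<beta> * n + (\<alpha> * m + k))"
      using x(1) y(1) zK by (simp add: \<psi>_def xp yp int_pow_mult m_assoc zx zy)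
    then have "\<psi> (i + int p * m, j + int p * n, k) = \<psi> (i, j, k')
        \<longleftrightarrow> z [^] (\<beta> * n + (\<alpha> * m + k)) = z [^] k'"
      using x(1) y(1) zK by (simp add: \<psi>_def)
    also have "\<dots> \<longleftrightarrow> int p dvd \<beta> * n + (\<alpha> * m + k) - k'"
      using int_pow_eq[OF zK] z(2) by (simp add: dvd_diff_commute)
    finally show ?thesis .
  qed
  have \<Phi>_shift: "\<Phi> (i + int p * m, j + int p * n, k) = \<Phi> (i, j, k') \<longleftrightarrow> int p dvd \<beta> * n + (\<alpha> * m + k) - k'"
    for i j k k' m n
  proof -
    have "int p * \<alpha> * (i + int p * m) + int p * \<beta> * (j + int p * n) + int p ^ 2 * k
        - (int p * \<alpha> * i + int p * \<beta> * j + int p ^ 2 * k') = int p ^ 2 * (\<beta> * n + (\<alpha> * m + k) - k')"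
      by (simp add: algebra_simps power2_eq_square)
    moreover have "int p ^ 3 dvd int p ^ 2 * u \<longleftrightarrow> int p dvd u" for u
    proof -
      have "int p ^ 3 = int p ^ 2 * int p" by (simp add: eval_nat_numeral)
      then show ?thesis using p0 by simp
    qed
    ultimately show ?thesis by (simp add: \<Phi>_def reduce_eq_iff right_diff_distrib[symmetric])
  qed
  have \<psi>_dvd: "int p dvd i - i' \<and> int p dvd j - j'" if eq: "\<psi> (i, j, k) = \<psi> (i', j', k')" for i j k i' j' k'
  proof -
    have 1: "x [^] i = x [^] i' \<otimes> x [^] (i - i')" "y [^] j' = y [^] (j' - j) \<otimes> y [^] j"
      "z [^] k' = z [^] (k' - k) \<otimes> z [^] k"
      using x(1) y(1) zK by (simp_all add: int_pow_mult[symmetric])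
    have "x [^] i' \<otimes> (x [^] (i - i') \<otimes> (y [^] j \<otimes> z [^] k))
        = x [^] i' \<otimes> (y [^] (j' - j) \<otimes> z [^] (k' - k) \<otimes> (y [^] j \<otimes> z [^] k))"
      using eq x(1) y(1) zK unfolding \<psi>_def prod.case 1 by (simp add: m_assoc zx zy)
    then have "x [^] (i - i') \<otimes> (y [^] j \<otimes> z [^] k) = y [^] (j' - j) \<otimes> z [^] (k' - k) \<otimes> (y [^] j \<otimes> z [^] k)"
      using x(1) y(1) zK by (subst (asm) l_cancel) auto
    then have 2: "x [^] (i - i') = y [^] (j' - j) \<otimes> z [^] (k' - k)"
      using x(1) y(1) zK by (subst (asm) r_cancel) auto
    have "x [^] (i - i') \<otimes> z [^] (k - k') = y [^] (j' - j)"
      unfolding 2 using y(1) zK by (simp add: m_assoc int_pow_mult[symmetric])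
    then have "y [^] (j' - j) \<in> B" unfolding B_iff by metis
    moreover have "y [^] p \<in> B" using AB \<beta> A_iff by auto
    ultimately have dj: "int p dvd j' - j" by (intro prime_dvd_exponent[OF p B y])
    then obtain n where "j' - j = int p * n" by blast
    then have "y [^] (j' - j) = z [^] (\<beta> * n)" using yp[of 0 n] zK by simp
    then have "x [^] (i - i') = z [^] (\<beta> * n + (k' - k))" using 2 zK by (simp add: int_pow_mult)
    then have "x [^] (i - i') \<in> A" using A_iff by blast
    moreover have "x [^] p \<in> A" using \<alpha> A_iff by auto
    ultimately have "int p dvd i - i'" by (intro prime_dvd_exponent[OF p A x])
    then show ?thesis using dj by (simp add: dvd_diff_commute)
  qed
  have \<psi>_eq: "\<psi> s = \<psi> t \<longleftrightarrow> \<Phi> s = \<Phi> t" for s t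
  proof -
    obtain i j k i' j' k' where st: "s = (i, j, k)" "t = (i', j', k')" by (metis surj_pair)
    show ?thesis
    proof (cases "int p dvd i - i' \<and> int p dvd j - j'")
      case True
      then obtain m n where "i - i' = int p * m" "j - j' = int p * n" by blast
      then have "i = i' + int p * m" "j = j' + int p * n" by simp_all
      then show ?thesis unfolding st using \<psi>_shift \<Phi>_shift by simp
    next
      case False
      moreover have "\<Phi> s = \<Phi> t \<Longrightarrow> int p dvd i - i' \<and> int p dvd j - j'"
        by (simp add: \<Phi>_def st reduce_eq_iff)
      ultimately show ?thesis using \<psi>_dvd unfolding st by blast
    qed
  qed
  have \<psi>_carrier: "range \<psi> \<subseteq> carrier K" using x(1) y(1) zK by (auto simp: \<psi>_def)
  have "inj_on \<psi> ({0..<int p} \<times> {0..<int p} \<times> {0..<int p})"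
  proof (rule inj_onI)
    fix s t assume "s \<in> {0..<int p} \<times> {0..<int p} \<times> {0..<int p}"
      "t \<in> {0..<int p} \<times> {0..<int p} \<times> {0..<int p}" and \<psi>_st: "\<psi> s = \<psi> t"
    then obtain i j k i' j' k' where st: "s = (i, j, k)" "t = (i', j', k')"
      and r: "i \<in> {0..<int p}" "j \<in> {0..<int p}" "k \<in> {0..<int p}"
      "i' \<in> {0..<int p}" "j' \<in> {0..<int p}" "k' \<in> {0..<int p}"
      by blast
    have eq: "\<psi> (i, j, k) = \<psi> (i', j', k')" using \<psi>_st st by simp
    have small: "u = v" if "int p dvd u - v" "u \<in> {0..<int p}" "v \<in> {0..<int p}" for u v
      using that by (simp add: mod_eq_dvd_iff[symmetric])
    have "i = i'" "j = j'" using \<psi>_dvd[OF eq] small r by blast+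
    then have "int p dvd k - k'" using \<psi>_shift[of i' 0 j' 0 k k'] eq by simp
    then show "s = t" using \<open>i = i'\<close> \<open>j = j'\<close> small r st by blast
  qed
  then have "card (\<psi> ` ({0..<int p} \<times> {0..<int p} \<times> {0..<int p})) = order K"
    using ord by (simp add: card_image card_cartesian_product eval_nat_numeral)
  then have "\<psi> ` ({0..<int p} \<times> {0..<int p} \<times> {0..<int p}) = carrier K"
    using fin \<psi>_carrier by (intro card_seteq) (auto simp: order_def)
  then have "carrier K = range \<psi>" using \<psi>_carrier by blast
  moreover have "range \<Phi> \<subseteq> carrier (universal_group p)"
    using reduce_in_carrier[OF p0] by (auto simp: \<Phi>_def)
  ultimately show ?thesis
    using embeddable_if_coordinates[OF \<open>group K\<close> group_universal_group[OF p0], of \<psi> f \<Phi>]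
      \<psi>_mult \<Phi>_mult \<psi>_eq by blast
qed

lemma embeds_all_of_order_universal_group:
  assumes p: "Factorial_Ring.prime p"
  shows "embeds_all_of_order (p ^ 3) (universal_group p)"
  unfolding embeds_all_of_order_def
proof (intro allI impI, elim conjE)
  fix K :: "nat monoid"
  assume K: "group K" "order K = p ^ 3"
  show "embeddable K (universal_group p)"
  proof (cases "\<exists>g\<in>carrier K. g [^]\<^bsub>K\<^esub> (p ^ 2) \<noteq> \<one>\<^bsub>K\<^esub>")
    case True
    then show ?thesis using cyclic_embeddable[OF K p] by blast
  next
    case False
    then show ?thesis using noncyclic_embeddable[OF K p] by blast
  qed
qed

section \<open>The lower bound\<close>

lemma inj_hom_image:
  assumes "group K" "group G" "h \<in> hom K G" "inj_on h (carrier K)"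
  shows "subgroup (h ` carrier K) G" "card (h ` carrier K) = order K"
proof -
  interpret group_hom K G h using assms by (simp add: group_hom_def group_hom_axioms_def)
  show "subgroup (h ` carrier K) G" by (rule img_is_subgroup)
  show "card (h ` carrier K) = order K" using assms(4) by (simp add: card_image order_def)
qed

text \<open>
  Every \<open>p\<close>-subgroup of \<open>G\<close> is conjugate to a subgroup of the Sylow subgroup
  \<open>P\<close>.
\<close>
lemma sylow_embeds_all:
  assumes G: "group G" "finite (carrier G)" and p: "Factorial_Ring.prime p"
    and P: "subgroup P G" "\<not> p dvd card (rcosets\<^bsub>G\<^esub> P)"
    and all: "embeds_all_of_order (p ^ k) G"
  shows "embeds_all_of_order (p ^ k) (G\<lparr>carrier := P\<rparr>)"
  unfolding embeds_all_of_order_def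
proof (intro allI impI, elim conjE)
  fix K :: "nat monoid"
  assume K: "group K" and ordK: "order K = p ^ k"
  interpret group G by fact
  have GP: "group (G\<lparr>carrier := P\<rparr>)" using P(1) by (rule subgroup_imp_group)
  obtain h where h: "h \<in> hom K G" "inj_on h (carrier K)"
    using all K ordK embeddableD unfolding embeds_all_of_order_def by blast
  note S = inj_hom_image[OF K G(1) h]
  obtain g where g: "g \<in> carrier G" "\<And>s. s \<in> h ` carrier K \<Longrightarrow> g \<otimes>\<^bsub>G\<^esub> s \<otimes>\<^bsub>G\<^esub> inv\<^bsub>G\<^esub> g \<in> P"
    using p_subgroup_conj_into[OF G(2) p S(1) _ P] S(2) ordK by metis
  define h' where "h' = (\<lambda>x. g \<otimes>\<^bsub>G\<^esub> h x \<otimes>\<^bsub>G\<^esub> inv\<^bsub>G\<^esub> g)"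
  have hG: "h x \<in> carrier G" if "x \<in> carrier K" for x using h(1) that by (auto simp: hom_def)
  have hom: "h' \<in> hom K (G\<lparr>carrier := P\<rparr>)"
    using g h(1) hG by (auto simp: hom_def h'_def conj_mult)
  have "inj_on h' (carrier K)"
    using h(2) hG g(1) by (auto simp: inj_on_def h'_def)
  with K GP hom show "embeddable K (G\<lparr>carrier := P\<rparr>)" by (rule embeddable_if_inj_hom)
qed

text \<open>
  A three-parameter family of tuples, with each parameter relevant modulo \<open>p\<close>, is a subgroup of
  order \<open>p\<^sup>3\<close>.
\<close>
lemma subgroup_range_reduce:
  assumes p0: "p > 0" and zero: "\<tau> (0, 0, 0) = (0, 0, 0, 0)"
    and closed: "\<And>s t. \<exists>u. raw_mult p (\<tau> s) (\<tau> t) = \<tau> u"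
    and inj: "\<And>i j k i' j' k'. reduce p (\<tau> (i, j, k)) = reduce p (\<tau> (i', j', k')) \<longleftrightarrow>
      int p dvd i - i' \<and> int p dvd j - j' \<and> int p dvd k - k'"
  shows "subgroup (range (\<lambda>t :: int \<times> int \<times> int. reduce p (\<tau> t))) (universal_group p)" (is "subgroup ?S ?U")
    and "card (range (\<lambda>t :: int \<times> int \<times> int. reduce p (\<tau> t))) = p ^ 3"
proof -
  interpret group ?U using p0 by (rule group_universal_group)
  have fin: "finite (carrier ?U)" by (simp add: universal_group_def)
  show "subgroup ?S ?U"
  proof (rule finite_subgroupI[OF fin])
    show "?S \<subseteq> carrier ?U" using reduce_in_carrier[OF p0] by blast
    show "reduce p (\<tau> (0, 0, 0)) \<in> ?S" by blast
    fix g h assume "g \<in> ?S" "h \<in> ?S"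
    then obtain s t where st: "g = reduce p (\<tau> s)" "h = reduce p (\<tau> t)" by blast
    obtain u where "raw_mult p (\<tau> s) (\<tau> t) = \<tau> u" using closed by blast
    then have "g \<otimes>\<^bsub>?U\<^esub> h = reduce p (\<tau> u)" unfolding st mult_reduce[OF p0] by simp
    then show "g \<otimes>\<^bsub>?U\<^esub> h \<in> ?S" by blast
  qed
  let ?I = "{0..<int p} \<times> {0..<int p} \<times> {0..<int p}"
  have "?S \<subseteq> (\<lambda>t. reduce p (\<tau> t)) ` ?I"
  proof
    fix g assume "g \<in> ?S"
    then obtain i j k where g: "g = reduce p (\<tau> (i, j, k))" by (metis imageE surj_pair)
    have "int p dvd u - u mod int p" for u by (simp add: mod_eq_dvd_iff[symmetric])
    then have "g = reduce p (\<tau> (i mod int p, j mod int p, k mod int p))" unfolding g inj by simp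
    then show "g \<in> (\<lambda>t. reduce p (\<tau> t)) ` ?I" using p0 by auto
  qed
  then have "?S = (\<lambda>t. reduce p (\<tau> t)) ` ?I" by blast
  moreover have "inj_on (\<lambda>t. reduce p (\<tau> t)) ?I"
  proof (rule inj_onI)
    fix s t assume "s \<in> ?I" "t \<in> ?I" and eq: "reduce p (\<tau> s) = reduce p (\<tau> t)"
    then obtain i j k i' j' k' where st: "s = (i, j, k)" "t = (i', j', k')"
      and r: "i \<in> {0..<int p}" "j \<in> {0..<int p}" "k \<in> {0..<int p}"
        "i' \<in> {0..<int p}" "j' \<in> {0..<int p}" "k' \<in> {0..<int p}"
      by blast
    have small: "u = v" if "int p dvd u - v" "u \<in> {0..<int p}" "v \<in> {0..<int p}" for u v
      using that by (simp add: mod_eq_dvd_iff[symmetric])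
    show "s = t" using eq small r unfolding st inj by blast
  qed
  ultimately show "card ?S = p ^ 3"
    by (simp add: card_image card_cartesian_product eval_nat_numeral)
qed

lemma nat_pow_prime_universal_group:
  assumes "p > 0" and odd: "odd p"
  shows "reduce p (int p ^ 2 * k, x, y, w) [^]\<^bsub>universal_group p\<^esub> p = \<one>\<^bsub>universal_group p\<^esub>"
proof -
  obtain m where m: "p choose 2 = p * m" using odd_dvd_choose_two[OF odd] by blast
  have "int p * (int p ^ 2 * k) + int p ^ 2 * (int (p choose 2) * (x * y)) = int p ^ 3 * (k + int m * (x * y))"
    unfolding m by (simp add: algebra_simps eval_nat_numeral)
  then show ?thesis
    unfolding nat_pow_universal_group[OF assms(1)] one_universal_group[OF assms(1)] reduce_eq_iff by simp
qed

definition elementary_abelian_subgroup :: "nat \<Rightarrow> (int \<times> int \<times> int \<times> int) set"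
  where "elementary_abelian_subgroup p = range (\<lambda>t. reduce p (case t of (k, x, w) \<Rightarrow> (int p ^ 2 * k, x, 0, w)))"

definition heisenberg_subgroup :: "nat \<Rightarrow> (int \<times> int \<times> int \<times> int) set"
  where "heisenberg_subgroup p = range (\<lambda>t. reduce p (case t of (k, x, y) \<Rightarrow> (int p ^ 2 * k, x, y, 0)))"

lemma cube_dvd_iff:
  assumes "p > 0"
  shows "int p ^ 3 dvd int p ^ 2 * k - int p ^ 2 * k' \<longleftrightarrow> int p dvd k - k'"
proof -
  have "int p ^ 2 * k - int p ^ 2 * k' = int p ^ 2 * (k - k')" "int p ^ 3 = int p ^ 2 * int p"
    by (simp_all add: right_diff_distrib eval_nat_numeral)
  then show ?thesis using assms by simp
qed

lemma elementary_abelian_subgroup: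
  assumes "p > 0"
  shows "subgroup (elementary_abelian_subgroup p) (universal_group p)"
    and "card (elementary_abelian_subgroup p) = p ^ 3"
proof -
  define \<tau> where "\<tau> = (\<lambda>(k, x, w). (int p ^ 2 * k, x :: int, 0 :: int, w :: int))"
  have "\<exists>u. raw_mult p (\<tau> s) (\<tau> t) = \<tau> u" for s t
  proof -
    obtain k x w k' x' w' where "s = (k, x, w)" "t = (k', x', w')" by (metis surj_pair)
    then have "raw_mult p (\<tau> s) (\<tau> t) = \<tau> (k + k', x + x', w + w')"
      by (simp add: \<tau>_def raw_mult_def algebra_simps)
    then show ?thesis by blast
  qed
  note sub = subgroup_range_reduce[of p \<tau>, OF assms _ this]
  have "elementary_abelian_subgroup p = range (\<lambda>t. reduce p (\<tau> t))"
    by (simp only: elementary_abelian_subgroup_def \<tau>_def)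
  then show "subgroup (elementary_abelian_subgroup p) (universal_group p)"
    "card (elementary_abelian_subgroup p) = p ^ 3"
    using sub by (auto simp: \<tau>_def reduce_eq_iff cube_dvd_iff[OF assms])
qed

lemma heisenberg_subgroup:
  assumes "p > 0"
  shows "subgroup (heisenberg_subgroup p) (universal_group p)"
    and "card (heisenberg_subgroup p) = p ^ 3"
proof -
  define \<tau> where "\<tau> = (\<lambda>(k, x, y). (int p ^ 2 * k, x :: int, y :: int, 0 :: int))"
  have "\<exists>u. raw_mult p (\<tau> s) (\<tau> t) = \<tau> u" for s t
  proof -
    obtain k x y k' x' y' where "s = (k, x, y)" "t = (k', x', y')" by (metis surj_pair)
    then have "raw_mult p (\<tau> s) (\<tau> t) = \<tau> (k + k' + y * x', x + x', y + y')"
      by (simp add: \<tau>_def raw_mult_def algebra_simps)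
    then show ?thesis by blast
  qed
  note sub = subgroup_range_reduce[of p \<tau>, OF assms _ this]
  have "heisenberg_subgroup p = range (\<lambda>t. reduce p (\<tau> t))"
    by (simp only: heisenberg_subgroup_def \<tau>_def)
  then show "subgroup (heisenberg_subgroup p) (universal_group p)"
    "card (heisenberg_subgroup p) = p ^ 3"
    using sub by (auto simp: \<tau>_def reduce_eq_iff cube_dvd_iff[OF assms])
qed

text \<open>
  Already the cyclic, the elementary abelian and the Heisenberg group of order \<open>p\<^sup>3\<close> do not
  fit together into a \<open>p\<close>-group of order at most \<open>p\<^sup>5\<close>.
\<close>
lemma p_group_exponent_lower_bound:
  fixes G (structure)
  assumes G: "group G" and ord: "order G = p ^ n" and p: "Factorial_Ring.prime p" and odd: "odd p"
    and all: "embeds_all_of_order (p ^ 3) G"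
  shows "n \<ge> 6"
proof (rule ccontr)
  assume "\<not> n \<ge> 6"
  then have n: "n \<le> 5" by simp
  have p1: "p > 1" and p0: "p > 0" using prime_gt_1_nat[OF p] by auto
  interpret group G by fact
  let ?U = "universal_group p" and ?C = "integer_mod_group (p ^ 3)"
  interpret U: group ?U using p0 by (rule group_universal_group)
  have "order ?C = p ^ 3"
    using p0 by (simp add: order_def carrier_integer_mod_group nat_power_eq)
  then obtain hC where hC: "hC \<in> hom ?C G" "inj_on hC (carrier ?C)"
    using embeddableD[OF embeds_all_of_orderD[OF all _ group_integer_mod_group]] p0 by auto
  interpret hC: group_hom ?C G hC using hC(1) G by (simp add: group_hom_def group_hom_axioms_def)
  define c where "c = hC 1"
  have "p ^ 3 \<noteq> 1" using p1 by simp
  then have one: "1 \<in> carrier ?C" by simp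
  have cG: "c \<in> carrier G" unfolding c_def using one by (rule hC.hom_closed)
  have c_pow: "c [^] k = \<one> \<longleftrightarrow> p ^ 3 dvd k" for k :: nat
  proof -
    have "c [^] k = hC (1 [^]\<^bsub>?C\<^esub> k)" unfolding c_def by (rule hC.hom_nat_pow[OF one, symmetric])
    then have "c [^] k = \<one> \<longleftrightarrow> hC (1 [^]\<^bsub>?C\<^esub> k) = hC \<one>\<^bsub>?C\<^esub>"
      by (simp only: hC.hom_one)
    also have "\<dots> \<longleftrightarrow> 1 [^]\<^bsub>?C\<^esub> k = \<one>\<^bsub>?C\<^esub>"
      by (intro inj_on_eq_iff[OF hC(2)] hC.nat_pow_closed one) simp
    also have "\<dots> \<longleftrightarrow> int k mod int (p ^ 3) = 0" by simp
    also have "\<dots> \<longleftrightarrow> p ^ 3 dvd k" by presburger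
    finally show ?thesis .
  qed
  have ordc: "ord c = p ^ 3" using ord_unique[OF cG] c_pow by blast

  \<comment> \<open>The image of an elementary abelian subgroup: it must contain every \<open>p\<close>-torsion element.\<close>
  let ?E = "?U\<lparr>carrier := elementary_abelian_subgroup p\<rparr>"
  note subE = elementary_abelian_subgroup[OF p0]
  have grpE: "group ?E" using subE(1) by (rule U.subgroup_imp_group)
  have ordE: "order ?E = p ^ 3" using subE(2) by (simp add: order_def)
  obtain hE where hE: "hE \<in> hom ?E G" "inj_on hE (carrier ?E)"
    using embeddableD[OF embeds_all_of_orderD[OF all _ grpE ordE]] p0 by auto
  interpret hE: group_hom ?E G hE using hE(1) G grpE by (simp add: group_hom_def group_hom_axioms_def)
  define E where "E = hE ` carrier ?E"
  have E: "subgroup E G" "card E = p ^ 3"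
    using inj_hom_image[OF grpE G hE] ordE by (simp_all only: E_def)
  have E_comm: "u \<otimes> v = v \<otimes> u" if uv: "u \<in> E" "v \<in> E" for u v
  proof -
    obtain s t where st: "s \<in> carrier ?E" "t \<in> carrier ?E" "u = hE s" "v = hE t"
      using uv by (auto simp: E_def)
    then have "s \<otimes>\<^bsub>?E\<^esub> t = t \<otimes>\<^bsub>?E\<^esub> s"
      by (auto simp: elementary_abelian_subgroup_def mult_reduce[OF p0] raw_mult_def add.commute)
    then show ?thesis using hE.hom_mult[OF st(1,2)] hE.hom_mult[OF st(2,1)] st(3,4) by simp
  qed
  have E_exp: "u [^] p = \<one>" if u: "u \<in> E" for u
  proof -
    obtain s where s: "s \<in> carrier ?E" "u = hE s" using u by (auto simp: E_def)
    then have "s [^]\<^bsub>?U\<^esub> p = \<one>\<^bsub>?U\<^esub>"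
      using nat_pow_prime_universal_group[OF p0 odd] by (auto simp: elementary_abelian_subgroup_def)
    then have "s [^]\<^bsub>?E\<^esub> p = \<one>\<^bsub>?E\<^esub>" by (simp add: U.nat_pow_consistent[symmetric])
    then have "u [^] p = hE \<one>\<^bsub>?E\<^esub>" unfolding s(2) using hE.hom_nat_pow[OF s(1), of p] by metis
    then show ?thesis by (simp only: hE.hom_one)
  qed

  let ?H = "?U\<lparr>carrier := heisenberg_subgroup p\<rparr>"
  note subH = heisenberg_subgroup[OF p0]
  have grpH: "group ?H" using subH(1) by (rule U.subgroup_imp_group)
  have ordH: "order ?H = p ^ 3" using subH(2) by (simp add: order_def)
  obtain hH where hH: "hH \<in> hom ?H G" "inj_on hH (carrier ?H)"
    using embeddableD[OF embeds_all_of_orderD[OF all _ grpH ordH]] p0 by auto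
  interpret hH: group_hom ?H G hH using hH(1) G grpH by (simp add: group_hom_def group_hom_axioms_def)
  have hHE: "hH s \<in> E" if s: "s \<in> carrier ?H" for s
  proof -
    have "s [^]\<^bsub>?U\<^esub> p = \<one>\<^bsub>?U\<^esub>"
      using s nat_pow_prime_universal_group[OF p0 odd] by (auto simp: heisenberg_subgroup_def)
    then have "s [^]\<^bsub>?H\<^esub> p = \<one>\<^bsub>?H\<^esub>" by (simp add: U.nat_pow_consistent[symmetric])
    then have "hH s [^] p = hH \<one>\<^bsub>?H\<^esub>" using hH.hom_nat_pow[OF s, of p] by metis
    then have "hH s [^] p = \<one>" by (simp only: hH.hom_one)
    then show ?thesis
      using exponent_p_elements_in_elementary_abelian[OF ord n p odd E E_comm E_exp cG ordc hH.hom_closed[OF s]]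
      by blast
  qed
  define s t where "s = reduce p (0, 1, 0, 0)" and "t = reduce p (0, 0, 1, 0)"
  have st: "s \<in> carrier ?H" "t \<in> carrier ?H"
  proof -
    show "s \<in> carrier ?H"
      by (auto simp: s_def heisenberg_subgroup_def intro!: image_eqI[of _ _ "(0, 1, 0)"])
    show "t \<in> carrier ?H"
      by (auto simp: t_def heisenberg_subgroup_def intro!: image_eqI[of _ _ "(0, 0, 1)"])
  qed
  have "hH (s \<otimes>\<^bsub>?H\<^esub> t) = hH (t \<otimes>\<^bsub>?H\<^esub> s)"
    using E_comm[OF hHE[OF st(1)] hHE[OF st(2)]] hH.hom_mult[OF st] hH.hom_mult[OF st(2,1)] by simp
  then have "s \<otimes>\<^bsub>?H\<^esub> t = t \<otimes>\<^bsub>?H\<^esub> s"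
    by (rule inj_onD[OF hH(2)]) (use st subgroup.m_closed[OF subH(1)] in simp_all)
  then have "reduce p (0, 1, 1, 0) = reduce p (int p ^ 2, 1, 1, 0)"
    by (simp add: s_def t_def mult_reduce[OF p0] raw_mult_def)
  then have "int p dvd 1"
    using cube_dvd_iff[OF p0, of 0 1] by (simp add: reduce_eq_iff)
  then show False using p1 by simp
qed

theorem mainTheorem5:
  fixes p :: nat and G :: "('a, 'b) monoid_scheme"
  assumes "Factorial_Ring.prime p" and "odd p"
    and "minimal_embedding_group (p ^ 3) G"
  shows "order G = p ^ 6"
proof -
  have p1: "p > 1" and p0: "p > 0" using prime_gt_1_nat[OF assms(1)] by auto
  have G: "group G" "finite (carrier G)" "embeds_all_of_order (p ^ 3) G"
    using assms(3) by (auto simp: minimal_embedding_group_def)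
  interpret group G by fact
  have "finite (carrier (universal_group p))" by (simp add: universal_group_def)
  then have le: "order G \<le> p ^ 6"
    using minimal_embedding_groupD[OF assms(3) group_universal_group[OF p0] _
        embeds_all_of_order_universal_group[OF assms(1)]] order_universal_group[OF p0] by simp
  have pos: "order G > 0" using G(2) order_gt_0_iff_finite by simp
  define a where "a = multiplicity p (order G)"
  obtain m where am: "order G = p ^ a * m" "\<not> p dvd m"
    using multiplicity_decompose'[of "order G" p] pos p1 by (auto simp: a_def)
  obtain P where P: "subgroup P G" "card P = p ^ a"
    using sylow_thm[OF assms(1) G(1) am(1) G(2)] by blast
  have "card (rcosets\<^bsub>G\<^esub> P) * p ^ a = p ^ a * m"
    using lagrange[OF P(1)] unfolding P(2) am(1) .
  then have "card (rcosets\<^bsub>G\<^esub> P) = m" using p0 by simp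
  then have "\<not> p dvd card (rcosets\<^bsub>G\<^esub> P)" using am(2) by simp
  then have "embeds_all_of_order (p ^ 3) (G\<lparr>carrier := P\<rparr>)"
    by (rule sylow_embeds_all[OF G(1,2) assms(1) P(1) _ G(3)])
  then have "a \<ge> 6"
    using p_group_exponent_lower_bound[OF subgroup_imp_group[OF P(1)] _ assms(1,2), of a] P(2)
    by (simp add: order_def)
  then have "p ^ 6 dvd order G" unfolding am(1) by (intro dvd_mult2 le_imp_power_dvd)
  then have "p ^ 6 \<le> order G" using pos by (rule dvd_imp_le)
  with le show ?thesis by simp
qed

end
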